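(* Let $(T,X)$ be a minimal surjective semiflow on a nonempty compact Hausdorff space $X$. Then the following are equivalent: (i) $P_{aa}(T,X)=X$; (ii) $(T,X)$ is equicontinuous and invertible; (iii) $(T,X)$ is an almost periodic (a.p.) semiflow.
   Context: $T$ is a topological semigroup with identity $e$. A semiflow $(T,X)$ is a jointly continuous map $T\times X\to X$, $(t,x)\mapsto tx$, with $ex=x$ and $t(sx)=(ts)x$. It is minimal if every orbit $Tx$ is dense in $X$, surjective if $tX=X$ for all $t\in T$, and invertible if each transition $x\mapsto tx$ is a bijection of $X$. $\mathscr U_X$ is the compatible (symmetric) uniformity of $X$, $\varepsilon[x]=\{y:(x,y)\in\varepsilon\}$. $x\in P_{aa}(T,X)$ (almost automorphic point) if for every net $\{t_n\}$ in $T$ and net $\{x_n'\}$ in $X$: $t_nx\to y$, $x_n'\to x'$ and $t_nx_n'=y$ for all $n$ imply $x=x'$. $(T,X)$ is equicontinuous if for every $x\in X$ and $\varepsilon\in\mathscr U_X$ there is $\delta\in\mathscr U_X$ such that $(x,x')\in\delta$ implies $(tx,tx')\in\varepsilon$ for all $t\in T$. A set $A\subseteq T$ is syndetic if there is a compact $K\subseteq T$ with $Kt\cap A\ne\emptyset$ for all $t\in T$. $(T,X)$ is almost periodic (a.p.) if for every $\varepsilon\in\mathscr U_X$ there is a syndetic $A\subseteq T$ with $Ax\subseteq\varepsilon[x]$ for all $x\in X$. *)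

theory Defs
  imports "HOL-Analysis.Analysis"
begin

section \<open>Semiflows\<close>

text \<open>A semiflow is given by its action map \<open>\<pi> t x\<close>, where the phase semigroup is a type of class
  \<^class>\<open>topological_monoid_mult\<close> (jointly continuous multiplication, with identity \<open>1\<close>; neither
  commutativity nor a separation axiom is assumed).\<close>

definition semiflow :: "('t::topological_monoid_mult \<Rightarrow> 'x::topological_space \<Rightarrow> 'x) \<Rightarrow> bool" where
  "semiflow \<pi> \<longleftrightarrow>
     continuous_on UNIV (\<lambda>(t, x). \<pi> t x) \<and>
     (\<forall>x. \<pi> 1 x = x) \<and>
     (\<forall>t s x. \<pi> t (\<pi> s x) = \<pi> (t * s) x)"

definition minimal_semiflow :: "('t \<Rightarrow> 'x::topological_space \<Rightarrow> 'x) \<Rightarrow> bool" where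
  "minimal_semiflow \<pi> \<longleftrightarrow> (\<forall>x. closure (range (\<lambda>t. \<pi> t x)) = UNIV)"

definition surjective_semiflow :: "('t \<Rightarrow> 'x \<Rightarrow> 'x) \<Rightarrow> bool" where
  "surjective_semiflow \<pi> \<longleftrightarrow> (\<forall>t. surj (\<pi> t))"

definition invertible_semiflow :: "('t \<Rightarrow> 'x \<Rightarrow> 'x) \<Rightarrow> bool" where
  "invertible_semiflow \<pi> \<longleftrightarrow> (\<forall>t. bij (\<pi> t))"


section \<open>Equicontinuity and almost periodicity\<close>

definition entourages :: "('x::uniform_space \<times> 'x) set set" where
  "entourages = {\<epsilon>. \<forall>\<^sub>F p in uniformity. p \<in> \<epsilon>}"

definition equicontinuous_semiflow :: "('t \<Rightarrow> 'x::uniform_space \<Rightarrow> 'x) \<Rightarrow> bool" where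
  "equicontinuous_semiflow \<pi> \<longleftrightarrow>
     (\<forall>x. \<forall>\<epsilon>\<in>entourages. \<exists>\<delta>\<in>entourages.
        \<forall>x'. (x, x') \<in> \<delta> \<longrightarrow> (\<forall>t. (\<pi> t x, \<pi> t x') \<in> \<epsilon>))"

definition syndetic :: "'t::topological_monoid_mult set \<Rightarrow> bool" where
  "syndetic A \<longleftrightarrow> (\<exists>K. compact K \<and> (\<forall>t. (\<lambda>k. k * t) ` K \<inter> A \<noteq> {}))"

definition ap_semiflow :: "('t::topological_monoid_mult \<Rightarrow> 'x::uniform_space \<Rightarrow> 'x) \<Rightarrow> bool" where
  "ap_semiflow \<pi> \<longleftrightarrow>
     (\<forall>\<epsilon>\<in>entourages. \<exists>A. syndetic A \<and> (\<forall>x. (\<lambda>t. \<pi> t x) ` A \<subseteq> \<epsilon> `` {x}))"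


section \<open>Nets and almost automorphic points\<close>

definition directed_preorder_on :: "'i set \<Rightarrow> ('i \<Rightarrow> 'i \<Rightarrow> bool) \<Rightarrow> bool" where
  "directed_preorder_on D le \<longleftrightarrow>
     D \<noteq> {} \<and> reflp_on D le \<and> transp_on D le \<and>
     (\<forall>a\<in>D. \<forall>b\<in>D. \<exists>c\<in>D. le a c \<and> le b c)"

text \<open>The filter generated by the tails of a directed set; a net \<open>f\<close> indexed by \<open>D\<close> converges to
  \<open>l\<close> iff \<open>(f \<longlongrightarrow> l) (net_filter D le)\<close>.\<close>

definition net_filter :: "'i set \<Rightarrow> ('i \<Rightarrow> 'i \<Rightarrow> bool) \<Rightarrow> 'i filter" where
  "net_filter D le = (INF n\<in>D. principal {m \<in> D. le n m})"

lemma eventually_net_filter: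
  assumes "directed_preorder_on D le"
  shows "eventually P (net_filter D le) \<longleftrightarrow> (\<exists>n\<in>D. \<forall>m\<in>D. le n m \<longrightarrow> P m)"
proof -
  have "eventually P (net_filter D le) \<longleftrightarrow> (\<exists>n\<in>D. eventually P (principal {m \<in> D. le n m}))"
    unfolding net_filter_def
  proof (rule eventually_INF_base)
    show "D \<noteq> {}" using assms by (simp add: directed_preorder_on_def)
    fix a b assume ab: "a \<in> D" "b \<in> D"
    then obtain c where c: "c \<in> D" "le a c" "le b c"
      using assms by (auto simp: directed_preorder_on_def)
    have tr: "transp_on D le" using assms by (simp add: directed_preorder_on_def)
    have "{m \<in> D. le c m} \<subseteq> {m \<in> D. le a m} \<inter> {m \<in> D. le b m}"
      using ab c transp_onD[OF tr] by blast
    then show "\<exists>x\<in>D. principal {m \<in> D. le x m}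
        \<le> inf (principal {m \<in> D. le a m}) (principal {m \<in> D. le b m})"
      using c by (auto intro!: bexI[of _ c])
  qed
  then show ?thesis by (auto simp: eventually_principal)
qed

text \<open>Almost automorphy tested on all nets whose index set is a directed subset of the type \<open>'i\<close>.\<close>

definition aa_point_wrt ::
    "'i itself \<Rightarrow> ('t \<Rightarrow> 'x::topological_space \<Rightarrow> 'x) \<Rightarrow> 'x \<Rightarrow> bool" where
  "aa_point_wrt I \<pi> x \<longleftrightarrow>
     (\<forall>(D :: 'i set) le (t :: 'i \<Rightarrow> 't) (x' :: 'i \<Rightarrow> 'x) y z.
        directed_preorder_on D le \<longrightarrow>
        ((\<lambda>n. \<pi> (t n) x) \<longlongrightarrow> y) (net_filter D le) \<longrightarrow>
        (x' \<longlongrightarrow> z) (net_filter D le) \<longrightarrow>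
        (\<forall>n\<in>D. \<pi> (t n) (x' n) = y) \<longrightarrow>
        x = z)"

text \<open>A definition cannot quantify over all index types. The index type fixed here is large enough
  to carry, for every net in \<open>'t \<times> 'x\<close>, a net with the same tails; lemma \<open>P_aa_all_nets\<close> below
  shows that it covers nets over directed sets in every type.\<close>

definition P_aa :: "('t \<Rightarrow> 'x::topological_space \<Rightarrow> 'x) \<Rightarrow> 'x set" where
  "P_aa \<pi> = {x. aa_point_wrt TYPE(('t \<times> 'x) set \<times> ('t \<times> 'x)) \<pi> x}"

lemma P_aa_all_nets:
  fixes \<pi> :: "'t \<Rightarrow> 'x::topological_space \<Rightarrow> 'x"
  assumes "x \<in> P_aa \<pi>"
  shows "aa_point_wrt TYPE('i) \<pi> x"
  unfolding aa_point_wrt_def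
proof (intro allI impI)
  fix D :: "'i set" and le t x' y z
  assume dir: "directed_preorder_on D le"
    and lim_t: "((\<lambda>n. \<pi> (t n) x) \<longlongrightarrow> y) (net_filter D le)"
    and lim_x: "(x' \<longlongrightarrow> z) (net_filter D le)"
    and eq: "\<forall>n\<in>D. \<pi> (t n) (x' n) = y"
  define h where "h n = (t n, x' n)" for n
  define tail where "tail n = h ` {m \<in> D. le n m}" for n
  define D' where "D' = {(A, p). \<exists>n\<in>D. A = tail n \<and> p \<in> A}"
  define le' :: "('t \<times> 'x) set \<times> ('t \<times> 'x) \<Rightarrow> ('t \<times> 'x) set \<times> ('t \<times> 'x) \<Rightarrow> bool"
    where "le' a b \<longleftrightarrow> fst b \<subseteq> fst a" for a b
  have refl: "n \<in> D \<Longrightarrow> le n n" for n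
    using dir by (auto simp: directed_preorder_on_def reflp_on_def)
  have trans: "transp_on D le"
    using dir by (simp add: directed_preorder_on_def)
  have mem: "n \<in> D \<Longrightarrow> (tail n, h n) \<in> D'" for n
    using refl by (auto simp: D'_def tail_def)
  have dir': "directed_preorder_on D' le'"
    unfolding directed_preorder_on_def
  proof (intro conjI ballI)
    show "D' \<noteq> {}" using mem dir by (auto simp: directed_preorder_on_def)
    show "reflp_on D' le'" "transp_on D' le'"
      by (auto simp: le'_def reflp_on_def transp_on_def)
    fix a b assume "a \<in> D'" "b \<in> D'"
    then obtain n m where nm: "n \<in> D" "m \<in> D" "fst a = tail n" "fst b = tail m"
      by (auto simp: D'_def)
    have "\<forall>a\<in>D. \<forall>b\<in>D. \<exists>c\<in>D. le a c \<and> le b c"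
      using dir by (simp add: directed_preorder_on_def)
    then obtain c where c: "c \<in> D" "le n c" "le m c"
      using nm(1,2) by blast
    have "tail c \<subseteq> tail n" "tail c \<subseteq> tail m"
      using nm c transp_onD[OF trans] unfolding tail_def by blast+
    then show "\<exists>c\<in>D'. le' a c \<and> le' b c"
      using mem[OF c(1)] nm by (intro bexI[of _ "(tail c, h c)"]) (auto simp: le'_def)
  qed
  have transfer: "eventually (\<lambda>i. P (snd i)) (net_filter D' le')"
    if ev: "eventually (\<lambda>n. P (h n)) (net_filter D le)" for P
  proof -
    obtain n where n: "n \<in> D" "\<forall>m\<in>D. le n m \<longrightarrow> P (h m)"
      using ev unfolding eventually_net_filter[OF dir] by blast
    have "\<forall>i\<in>D'. le' (tail n, h n) i \<longrightarrow> P (snd i)"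
    proof (intro ballI impI)
      fix i assume "i \<in> D'" "le' (tail n, h n) i"
      then have "snd i \<in> tail n" by (auto simp: D'_def le'_def)
      then show "P (snd i)" using n by (auto simp: tail_def)
    qed
    then show ?thesis
      unfolding eventually_net_filter[OF dir'] using mem[OF n(1)] by blast
  qed
  have 1: "((\<lambda>i. \<pi> (fst (snd i)) x) \<longlongrightarrow> y) (net_filter D' le')"
    unfolding tendsto_def
  proof (intro allI impI)
    fix S assume "open S" "y \<in> S"
    then have "eventually (\<lambda>n. \<pi> (fst (h n)) x \<in> S) (net_filter D le)"
      using lim_t by (auto simp: tendsto_def h_def)
    then show "eventually (\<lambda>i. \<pi> (fst (snd i)) x \<in> S) (net_filter D' le')"
      by (rule transfer)
  qed
  have 2: "((\<lambda>i. snd (snd i)) \<longlongrightarrow> z) (net_filter D' le')"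
    unfolding tendsto_def
  proof (intro allI impI)
    fix S assume "open S" "z \<in> S"
    then have "eventually (\<lambda>n. snd (h n) \<in> S) (net_filter D le)"
      using lim_x by (auto simp: tendsto_def h_def)
    then show "eventually (\<lambda>i. snd (snd i) \<in> S) (net_filter D' le')"
      by (rule transfer)
  qed
  have 3: "\<forall>i\<in>D'. \<pi> (fst (snd i)) (snd (snd i)) = y"
    using eq by (auto simp: D'_def tail_def h_def)
  from assms have "aa_point_wrt TYPE(('t \<times> 'x) set \<times> ('t \<times> 'x)) \<pi> x"
    by (simp add: P_aa_def)
  from this[unfolded aa_point_wrt_def, rule_format, OF dir' 1 2] 3
  show "x = z" by blast
qed

end

theory Submission
  imports Defs
begin

text \<open>
  Total boundedness in the uniform metric makes iterates recurrent: some power \<open>t\<^sup>k\<close> of each \<open>t\<close> is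
  uniformly close to the identity, so \<open>t\<^sup>k\<^sup>-\<^sup>1\<close> is an approximate inverse of \<open>t\<close>. For an equicontinuous
  surjective semiflow this gives both distality, hence almost automorphy, and almost periodicity.
  Almost periodicity in turn makes the inverses of the transitions equicontinuous, and the same
  recurrence argument, applied to the inverses, makes the transitions equicontinuous.

  If all points are almost automorphic, then \<open>t \<rightarrow> p\<close> pointwise implies \<open>t\<^sup>-\<^sup>1 \<rightarrow> p\<^sup>-\<^sup>1\<close>. Hence the
  enveloping semigroup (the pointwise closure of the transitions in \<open>X\<^sup>X\<close>) is a group with continuous
  inversion, and by minimality it consists of continuous maps. For a countable submonoid of \<open>T\<close> the
  closure \<open>G\<close> is a compact group covered by countably many uniformly small sets, because each \<open>p\<close> in
  \<open>G\<close> has its modulus of continuity controlled by finitely many members of the submonoid. By Baire category a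
  nonempty open subset of \<open>G\<close> is uniformly small, and its right translates cover \<open>G\<close>; so the
  transitions are totally bounded, which is equicontinuity.
\<close>

section \<open>The space of all maps under pointwise convergence\<close>

lemma Hausdorff_space_fun:
  "Hausdorff_space (euclidean :: ('a \<Rightarrow> 'b::t2_space) topology)"
proof -
  have "Hausdorff_space (euclidean :: 'b topology)"
    unfolding Hausdorff_space_def disjnt_def by (metis hausdorff open_openin)
  then show ?thesis
    unfolding euclidean_product_topology[symmetric] by (simp add: Hausdorff_space_product_topology)
qed

lemma compact_imp_closed_fun:
  "compact (C :: ('a \<Rightarrow> 'b::t2_space) set) \<Longrightarrow> closed C"
  using compactin_imp_closedin[OF Hausdorff_space_fun] by (metis compactin_euclidean_iff closed_closedin)

lemma compact_UNIV_fun: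
  assumes "compact (UNIV :: 'b::topological_space set)"
  shows "compact (UNIV :: ('a \<Rightarrow> 'b) set)"
proof -
  have "compact_space (product_topology (\<lambda>_::'a. euclidean :: 'b topology) UNIV)"
    using assms by (subst compact_space_product_topology) (simp add: compact_space_def)
  then show ?thesis
    by (simp add: euclidean_product_topology compact_space_def)
qed

text \<open>The open sets inside each \<open>R x\<close> cover the space. The relational form lets
  later covers be given by filter statements, for entourages, moduli of continuity and conditions on
  pairs alike.\<close>

lemma compact_UNIV_cover:
  assumes "compact (UNIV :: 'a::topological_space set)"
    and "\<And>x. \<forall>\<^sub>F y in nhds x. R x y"
  shows "\<exists>P. finite P \<and> (\<forall>y::'a. \<exists>x\<in>P. R x y)"
proof -
  obtain U where U: "\<And>x. open (U x)" "\<And>x. x \<in> U x" "\<And>x y. y \<in> U x \<Longrightarrow> R x y"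
    using assms(2) unfolding eventually_nhds by metis
  obtain P where P: "finite P" "UNIV \<subseteq> (\<Union>x\<in>P. U x)"
    by (rule compactE_image[OF assms(1), of UNIV U]) (use U in auto)
  have "\<exists>x\<in>P. R x y" for y
    using subsetD[OF P(2), of y] U(3) by auto
  then show ?thesis
    using P(1) by auto
qed

section \<open>Uniform equicontinuity and total boundedness\<close>

lemma entourage_refl: "E \<in> entourages \<Longrightarrow> (x, x) \<in> E"
  unfolding entourages_def using uniformity_refl by blast

lemma entourage_Int: "D \<in> entourages \<Longrightarrow> E \<in> entourages \<Longrightarrow> D \<inter> E \<in> entourages"
  by (simp add: entourages_def eventually_conj_iff)

lemma entourage_INT:
  "finite I \<Longrightarrow> (\<And>i. i \<in> I \<Longrightarrow> E i \<in> entourages) \<Longrightarrow> (\<Inter>i\<in>I. E i) \<in> entourages"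
  by (simp add: entourages_def eventually_ball_finite)

lemma entourage_half:
  assumes "E \<in> entourages"
  obtains D where "D \<in> entourages" "sym D" "D O D \<subseteq> E"
proof -
  obtain P where P: "eventually P uniformity" "\<And>x y z. P (x, y) \<Longrightarrow> P (y, z) \<Longrightarrow> (x, z) \<in> E"
    using assms uniformity_transE[of "\<lambda>p. p \<in> E"] unfolding entourages_def by blast
  define D where "D = {p. P p} \<inter> {(x, y). P (y, x)}"
  have "{(x, y). P (y, x)} \<in> entourages"
    using uniformity_sym[OF P(1)] by (simp add: entourages_def case_prod_unfold)
  then have "D \<in> entourages"
    unfolding D_def using P(1) by (intro entourage_Int) (auto simp: entourages_def)
  moreover have "sym D" "D O D \<subseteq> E"
    using P(2) by (auto simp: D_def sym_def)
  ultimately show thesis by (rule that)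
qed

lemma entourage_quarter:
  assumes "E \<in> entourages"
  obtains D where "D \<in> entourages" "sym D" "D O D O D O D \<subseteq> E" "D \<subseteq> E" "D O D \<subseteq> E" "D O D O D \<subseteq> E"
proof -
  obtain C where C: "C \<in> entourages" "sym C" "C O C \<subseteq> E" by (rule entourage_half[OF assms])
  obtain D where D: "D \<in> entourages" "sym D" "D O D \<subseteq> C" by (rule entourage_half[OF C(1)])
  have DC: "D \<subseteq> C" and CE: "C \<subseteq> E"
    using D(3) C(3) entourage_refl[OF D(1)] entourage_refl[OF C(1)] by (auto simp: subset_iff relcomp.simps) metis+
  have "D O D O D \<subseteq> C O C" "(D O D) O (D O D) \<subseteq> C O C"
    using DC D(3) by (intro relcomp_mono; simp)+
  then show thesis using that[of D] D DC C(3) CE by (simp add: O_assoc)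
qed

lemma eventually_nhds_entourage: "E \<in> entourages \<Longrightarrow> \<forall>\<^sub>F y in nhds x. (x, y) \<in> E"
  unfolding eventually_nhds_uniformity entourages_def by (auto elim: eventually_mono)

lemma entourage_of_nhds:
  "\<forall>\<^sub>F y in nhds x. P y \<Longrightarrow> \<exists>E\<in>entourages. \<forall>y. (x, y) \<in> E \<longrightarrow> P y"
  unfolding eventually_nhds_uniformity
  \<comment> \<open>This relation constrains only pairs with first coordinate \<open>x\<close>,
    which is how the uniformity encodes the neighbourhoods of \<open>x\<close>.\<close>
  by (intro bexI[of _ "{(x', y). x' = x \<longrightarrow> P y}"]) (auto simp: entourages_def case_prod_unfold)

lemma tendsto_iff_entourage:
  "(f \<longlongrightarrow> l) F \<longleftrightarrow> (\<forall>E\<in>entourages. \<forall>\<^sub>F i in F. (l, f i) \<in> E)"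
proof
  assume "(f \<longlongrightarrow> l) F"
  then show "\<forall>E\<in>entourages. \<forall>\<^sub>F i in F. (l, f i) \<in> E"
    unfolding filterlim_iff using eventually_nhds_entourage by blast
next
  assume *: "\<forall>E\<in>entourages. \<forall>\<^sub>F i in F. (l, f i) \<in> E"
  show "(f \<longlongrightarrow> l) F"
    unfolding filterlim_iff
  proof (intro allI impI)
    fix P assume "\<forall>\<^sub>F y in nhds l. P y"
    then obtain E where "E \<in> entourages" "\<forall>y. (l, y) \<in> E \<longrightarrow> P y"
      using entourage_of_nhds by blast
    with * show "\<forall>\<^sub>F i in F. P (f i)" by (metis (mono_tags, lifting) eventually_mono)
  qed
qed

lemma continuous_entourage:
  assumes "continuous_on UNIV f" "E \<in> entourages"
  shows "\<forall>\<^sub>F y in nhds x. (f x, f y) \<in> E"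
proof -
  have "(f \<longlongrightarrow> f x) (nhds x)"
    using assms(1) tendsto_at_iff_tendsto_nhds[of f x] by (simp add: continuous_on_def)
  then show ?thesis using assms(2) tendsto_iff_entourage by blast
qed

lemma entourages_separate:
  fixes x y :: "'a::{uniform_space, t2_space}"
  assumes "\<And>E. E \<in> entourages \<Longrightarrow> (x, y) \<in> E"
  shows "x = y"
proof (rule ccontr)
  assume "x \<noteq> y"
  then obtain U where "open U" "x \<in> U" "y \<notin> U" using t1_space by blast
  then have "\<forall>\<^sub>F z in nhds x. z \<noteq> y" by (auto simp: eventually_nhds)
  then show False using entourage_of_nhds assms by blast
qed

section \<open>Equicontinuous and totally bounded families of maps\<close>

definition uniformly_equicontinuous :: "('a::uniform_space \<Rightarrow> 'a) set \<Rightarrow> bool" where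
  "uniformly_equicontinuous F \<longleftrightarrow>
     (\<forall>E\<in>entourages. \<exists>D\<in>entourages. \<forall>f\<in>F. \<forall>x y. (x, y) \<in> D \<longrightarrow> (f x, f y) \<in> E)"

text \<open>Smallness of order \<open>E\<close> in the uniformity of uniform convergence.\<close>

definition uniformly_small :: "('a \<times> 'a) set \<Rightarrow> ('b \<Rightarrow> 'a) set \<Rightarrow> bool" where
  "uniformly_small E C \<longleftrightarrow> (\<forall>p\<in>C. \<forall>q\<in>C. \<forall>x. (p x, q x) \<in> E)"

text \<open>Total boundedness of \<open>F\<close> at scale \<open>E\<close> for uniform convergence;
  the cells may contain maps outside \<open>F\<close>.\<close>

definition small_cover :: "('a \<times> 'a) set \<Rightarrow> ('b \<Rightarrow> 'a) set \<Rightarrow> bool" where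
  "small_cover E F \<longleftrightarrow> (\<exists>\<C>. finite \<C> \<and> F \<subseteq> \<Union>\<C> \<and> (\<forall>C\<in>\<C>. uniformly_small E C))"

text \<open>Heine-Cantor for a family: compactness merges the local moduli at finitely many points
  into one.\<close>

lemma uniformly_equicontinuousI:
  assumes comp: "compact (UNIV :: 'a::uniform_space set)"
    and eq: "\<And>E x. E \<in> entourages \<Longrightarrow> \<forall>\<^sub>F y in nhds x. \<forall>f\<in>F. (f x, f y) \<in> E"
  shows "uniformly_equicontinuous (F :: ('a \<Rightarrow> 'a) set)"
  unfolding uniformly_equicontinuous_def
proof
  fix E :: "('a \<times> 'a) set"
  assume "E \<in> entourages"
  then obtain D where D: "D \<in> entourages" "sym D" "D O D \<subseteq> E" by (rule entourage_half)
  \<comment> \<open>\<open>V\<close> is half of a modulus at \<open>x\<close>: a point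
    \<open>V\<close>-close to \<open>x\<close> and any point \<open>V\<close>-close to that one both
    fall under the modulus.\<close>
  have "\<exists>V\<in>entourages. \<forall>y. (x, y) \<in> V O V \<longrightarrow> (\<forall>f\<in>F. (f x, f y) \<in> D)" for x
  proof -
    obtain W where "W \<in> entourages" "\<forall>y. (x, y) \<in> W \<longrightarrow> (\<forall>f\<in>F. (f x, f y) \<in> D)"
      using entourage_of_nhds[OF eq[OF D(1)]] by blast
    moreover obtain V where "V \<in> entourages" "V O V \<subseteq> W"
      using \<open>W \<in> entourages\<close> by (rule entourage_half)
    ultimately show ?thesis by (intro bexI[of _ V]) auto
  qed
  then obtain V where V: "\<And>x. V x \<in> entourages"
    "\<And>x y f. (x, y) \<in> V x O V x \<Longrightarrow> f \<in> F \<Longrightarrow> (f x, f y) \<in> D"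
    by metis
  have "\<forall>\<^sub>F y in nhds x. (x, y) \<in> V x" for x
    by (rule eventually_nhds_entourage[OF V(1)])
  from compact_UNIV_cover[OF comp this]
  obtain P where P: "finite P" "\<And>y. \<exists>x\<in>P. (x, y) \<in> V x"
    by blast
  show "\<exists>D\<in>entourages. \<forall>f\<in>F. \<forall>x y. (x, y) \<in> D \<longrightarrow> (f x, f y) \<in> E"
  proof (intro bexI[of _ "\<Inter>x\<in>P. V x"] ballI allI impI)
    show "(\<Inter>x\<in>P. V x) \<in> entourages" using P(1) V(1) by (rule entourage_INT)
    fix f y y' assume f: "f \<in> F" and yy': "(y, y') \<in> (\<Inter>x\<in>P. V x)"
    obtain x where x: "x \<in> P" "(x, y) \<in> V x" using P(2) by blast
    then have "(x, y) \<in> V x O V x" "(x, y') \<in> V x O V x"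
      using yy' entourage_refl[OF V(1)] by blast+
    then have "(f x, f y) \<in> D" "(f x, f y') \<in> D" using V(2) f by blast+
    then show "(f y, f y') \<in> E" using D by (meson relcompI subsetD symD)
  qed
qed

lemma uniformly_equicontinuous_continuous:
  assumes "uniformly_equicontinuous F" "E \<in> entourages"
  shows "\<forall>\<^sub>F y in nhds x. \<forall>f\<in>F. (f x, f y) \<in> E"
proof -
  obtain D where "D \<in> entourages" "\<forall>f\<in>F. \<forall>x y. (x, y) \<in> D \<longrightarrow> (f x, f y) \<in> E"
    using assms unfolding uniformly_equicontinuous_def by blast
  with eventually_nhds_entourage[of D x] show ?thesis
    by (auto elim: eventually_mono)
qed

lemma equicontinuous_semiflow_iff:
  fixes \<pi> :: "'t \<Rightarrow> 'a::uniform_space \<Rightarrow> 'a"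
  assumes "compact (UNIV :: 'a set)"
  shows "equicontinuous_semiflow \<pi> \<longleftrightarrow> uniformly_equicontinuous (range \<pi>)"
proof
  assume *: "equicontinuous_semiflow \<pi>"
  show "uniformly_equicontinuous (range \<pi>)"
  proof (rule uniformly_equicontinuousI[OF assms])
    fix E :: "('a \<times> 'a) set" and x
    assume "E \<in> entourages"
    then obtain D where "D \<in> entourages" "\<forall>x'. (x, x') \<in> D \<longrightarrow> (\<forall>t. (\<pi> t x, \<pi> t x') \<in> E)"
      using * unfolding equicontinuous_semiflow_def by blast
    with eventually_nhds_entourage[of D x] show "\<forall>\<^sub>F y in nhds x. \<forall>f\<in>range \<pi>. (f x, f y) \<in> E"
      by (auto elim: eventually_mono)
  qed
next
  assume "uniformly_equicontinuous (range \<pi>)"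
  then show "equicontinuous_semiflow \<pi>"
    unfolding uniformly_equicontinuous_def equicontinuous_semiflow_def by (metis rangeI)
qed

text \<open>A map in \<open>F\<close> is determined up to \<open>E\<close> by which cell of a finite partition contains
  its value at each point of \<open>P\<close>.\<close>

lemma small_coverI:
  assumes comp: "compact (UNIV :: 'a::uniform_space set)"
    and D: "D \<in> entourages" "sym D" "D O D O D O D \<subseteq> E"
    and P: "finite P" "\<And>x. \<exists>z\<in>P. \<forall>f\<in>F. (f x, f z) \<in> D"
  shows "small_cover E (F :: ('b \<Rightarrow> 'a) set)"
proof -
  obtain N where N: "finite N" "\<And>y. \<exists>x\<in>N. (x, y) \<in> D"
    using compact_UNIV_cover[OF comp eventually_nhds_entourage[OF D(1)]] by metis
  \<comment> \<open>\<open>c\<close> rounds each value to the finite net \<open>N\<close>; the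
    rounded values on \<open>P\<close> index the cells.\<close>
  then obtain c where c: "\<And>y. c y \<in> N" "\<And>y. (c y, y) \<in> D" by metis
  define C where "C h = {f \<in> F. restrict (\<lambda>z. c (f z)) P = h}" for h
  have "uniformly_small E (C h)" for h
    unfolding uniformly_small_def
  proof (intro ballI allI)
    fix f g x assume fg: "f \<in> C h" "g \<in> C h"
    obtain z where z: "z \<in> P" "\<forall>f\<in>F. (f x, f z) \<in> D" using P(2) by blast
    have "restrict (\<lambda>z. c (f z)) P z = restrict (\<lambda>z. c (g z)) P z"
      using fg unfolding C_def by simp
    then have "c (f z) = c (g z)" using z(1) by simp
    moreover have "(f x, f z) \<in> D" "(g z, g x) \<in> D" using fg z D(2) by (auto simp: C_def dest: symD)
    moreover have "(f z, c (f z)) \<in> D" "(c (g z), g z) \<in> D" using c(2) D(2) by (auto dest: symD)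
    \<comment> \<open>The four steps run from \<open>f x\<close> to \<open>f z\<close>, to the
      common rounded value, to \<open>g z\<close>, to \<open>g x\<close>.\<close>
    ultimately have "(f x, g x) \<in> D O D O D O D" by (metis relcompI)
    then show "(f x, g x) \<in> E" using D(3) by blast
  qed
  moreover have "finite (C ` (P \<rightarrow>\<^sub>E N))" using P(1) N(1) by (simp add: finite_PiE)
  moreover have "F \<subseteq> \<Union>(C ` (P \<rightarrow>\<^sub>E N))"
    using c(1) by (auto simp: C_def)
  ultimately show ?thesis unfolding small_cover_def by blast
qed

text \<open>One half of Arzela-Ascoli: by equicontinuity the values on a finite set of points
  determine a map up to a small error.\<close>

lemma uniformly_equicontinuous_imp_small_cover:
  assumes comp: "compact (UNIV :: 'a::uniform_space set)"
    and F: "uniformly_equicontinuous (F :: ('a \<Rightarrow> 'a) set)" and E: "E \<in> entourages"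
  shows "small_cover E F"
proof -
  obtain D where D: "D \<in> entourages" "sym D" "D O D O D O D \<subseteq> E"
    by (rule entourage_quarter[OF E])
  obtain P where P: "finite P" "\<And>y. \<exists>x\<in>P. \<forall>f\<in>F. (f x, f y) \<in> D"
    using compact_UNIV_cover[OF comp uniformly_equicontinuous_continuous[OF F D(1)]] by metis
  then have "\<exists>x\<in>P. \<forall>f\<in>F. (f y, f x) \<in> D" for y
    using D(2) by (meson symD)
  then show ?thesis
    by (rule small_coverI[OF comp D P(1)])
qed

text \<open>The other half of Arzela-Ascoli: every map is uniformly close to one of finitely many
  continuous representatives, and these share a modulus at each point.\<close>

lemma small_cover_imp_uniformly_equicontinuous:
  assumes comp: "compact (UNIV :: 'a::uniform_space set)"
    and cov: "\<And>E. E \<in> entourages \<Longrightarrow> small_cover E F"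
    and cont: "\<And>f. f \<in> F \<Longrightarrow> continuous_on UNIV f"
  shows "uniformly_equicontinuous (F :: ('a \<Rightarrow> 'a) set)"
proof (rule uniformly_equicontinuousI[OF comp])
  fix E :: "('a \<times> 'a) set" and x :: 'a
  assume "E \<in> entourages"
  then obtain D where D: "D \<in> entourages" "sym D" "D O D O D \<subseteq> E"
    by (rule entourage_quarter)
  obtain \<C> where \<C>: "finite \<C>" "F \<subseteq> \<Union>\<C>" "\<And>C. C \<in> \<C> \<Longrightarrow> uniformly_small D C"
    using cov[OF D(1)] unfolding small_cover_def by blast
  \<comment> \<open>Only cells meeting \<open>F\<close> have a representative known to be
    continuous.\<close>
  define \<D> where "\<D> = {C \<in> \<C>. C \<inter> F \<noteq> {}}"
  have "\<forall>C\<in>\<D>. \<exists>g. g \<in> C \<inter> F" by (auto simp: \<D>_def)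
  then obtain g where g: "\<And>C. C \<in> \<D> \<Longrightarrow> g C \<in> C \<inter> F" by metis
  have "\<forall>\<^sub>F y in nhds x. \<forall>C\<in>\<D>. (g C x, g C y) \<in> D"
    using \<C>(1) g cont D(1) by (intro eventually_ball_finite) (auto simp: \<D>_def intro!: continuous_entourage)
  then show "\<forall>\<^sub>F y in nhds x. \<forall>f\<in>F. (f x, f y) \<in> E"
  proof (rule eventually_mono, intro ballI)
    fix y f assume *: "\<forall>C\<in>\<D>. (g C x, g C y) \<in> D" and "f \<in> F"
    then obtain C where C: "C \<in> \<C>" "f \<in> C" "C \<in> \<D>" using \<C>(2) unfolding \<D>_def by blast
    then have "(f x, g C x) \<in> D" "(g C y, f y) \<in> D"
      using \<C>(3) g unfolding uniformly_small_def by blast+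
    then show "(f x, f y) \<in> E" using * C(3) D(3) by blast
  qed
qed

text \<open>By the pigeonhole principle two powers \<open>f ^^ m\<close> and \<open>f ^^ n\<close>
  lie in one cell; surjectivity of \<open>f ^^ m\<close> then cancels it, leaving
  \<open>f ^^ (n - m)\<close> close to the identity.\<close>

lemma uniformly_recurrent:
  assumes cov: "small_cover E F" and surj: "surj f" and pow: "\<And>n. f ^^ n \<in> F"
  obtains k where "\<And>x. (x, (f ^^ Suc k) x) \<in> E"
proof -
  obtain \<C> where \<C>: "finite \<C>" "F \<subseteq> \<Union>\<C>" "\<And>C. C \<in> \<C> \<Longrightarrow> uniformly_small E C"
    using cov unfolding small_cover_def by blast
  have "\<forall>n. \<exists>C\<in>\<C>. f ^^ n \<in> C" using \<C>(2) pow by blast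
  then obtain c where c: "\<And>n. c n \<in> \<C>" "\<And>n. f ^^ n \<in> c n" by metis
  have "\<not> inj c"
    using c(1) \<C>(1) by (metis finite_subset image_subsetI infinite_UNIV_nat finite_imageD)
  then obtain m n where mn: "m < n" "c m = c n"
    unfolding inj_def by (metis linorder_neqE_nat)
  then have "\<forall>x. ((f ^^ m) x, (f ^^ n) x) \<in> E"
    using c \<C>(3) unfolding uniformly_small_def by metis
  \<comment> \<open>Since \<open>m < n\<close>, the exponent \<open>Suc (n - Suc m)\<close> is
    \<open>n - m\<close>, displayed as positive.\<close>
  moreover have "f ^^ n = f ^^ Suc (n - Suc m) \<circ> f ^^ m"
    using mn(1) by (subst funpow_add[symmetric]) simp
  moreover have "surj (f ^^ m)" using surj by (rule surj_fn)
  ultimately have "\<forall>y. (y, (f ^^ Suc (n - Suc m)) y) \<in> E" by (metis comp_apply surjD)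
  then show thesis using that by blast
qed

text \<open>A power \<open>f ^^ Suc k\<close> close to the identity makes \<open>f ^^ k\<close> an approximate inverse of \<open>f\<close>.\<close>

lemma uniformly_equicontinuous_backward:
  assumes comp: "compact (UNIV :: 'a::uniform_space set)"
    and F: "uniformly_equicontinuous (F :: ('a \<Rightarrow> 'a) set)"
    and surj: "\<And>f. f \<in> F \<Longrightarrow> surj f" and pow: "\<And>f n. f \<in> F \<Longrightarrow> f ^^ n \<in> F"
    and E: "E \<in> entourages"
  obtains D where "D \<in> entourages" "\<And>f x y. f \<in> F \<Longrightarrow> (f x, f y) \<in> D \<Longrightarrow> (x, y) \<in> E"
proof -
  obtain W where W: "W \<in> entourages" "sym W" "W O W O W \<subseteq> E"
    by (rule entourage_quarter[OF E])
  obtain D where D: "D \<in> entourages" "\<And>f x y. f \<in> F \<Longrightarrow> (x, y) \<in> D \<Longrightarrow> (f x, f y) \<in> W"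
    using F W(1) unfolding uniformly_equicontinuous_def by metis
  have "(x, y) \<in> E" if f: "f \<in> F" "(f x, f y) \<in> D" for f x y
  proof -
    obtain k where k: "\<And>x. (x, (f ^^ Suc k) x) \<in> W"
      using uniformly_recurrent[OF uniformly_equicontinuous_imp_small_cover[OF comp F W(1)]
          surj[OF f(1)] pow[OF f(1)]] by metis
    \<comment> \<open>\<open>f ^^ Suc k\<close> applies \<open>f\<close> first, so the common
      modulus for \<open>f ^^ k\<close> acts on the close pair \<open>(f x, f y)\<close>.\<close>
    have "((f ^^ Suc k) x, (f ^^ Suc k) y) \<in> W"
      using D(2)[OF pow[OF f(1), of k] f(2)] by (simp add: funpow_swap1)
    then have "(x, y) \<in> W O W O W" using k[of x] k[of y] W(2) by (meson relcompI symD)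
    then show ?thesis using W(3) by blast
  qed
  then show thesis using that D(1) by blast
qed

section \<open>Equicontinuous and almost periodic semiflows\<close>

lemma semiflow_one: "semiflow \<pi> \<Longrightarrow> \<pi> 1 = id"
  by (rule ext) (simp add: semiflow_def)

lemma semiflow_comp: "semiflow \<pi> \<Longrightarrow> \<pi> s \<circ> \<pi> t = \<pi> (s * t)"
  unfolding semiflow_def by auto

lemma semiflow_funpow: "semiflow \<pi> \<Longrightarrow> \<pi> t ^^ n = \<pi> (t ^ n)"
  by (induction n) (simp_all add: semiflow_one semiflow_comp id_def)

lemma semiflow_tendsto:
  assumes "semiflow \<pi>"
  shows "((\<lambda>(t, x). \<pi> t x) \<longlongrightarrow> \<pi> t x) (nhds (t, x))"
proof -
  have "continuous_on UNIV (\<lambda>(t, x). \<pi> t x)"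
    using assms unfolding semiflow_def by blast
  then show ?thesis
    using tendsto_at_iff_tendsto_nhds[of "\<lambda>(t, x). \<pi> t x" "(t, x)"] by (simp add: continuous_on_def)
qed

lemma semiflow_continuous: "semiflow \<pi> \<Longrightarrow> continuous_on UNIV (\<pi> t)"
  using continuous_on_compose2[of UNIV "\<lambda>(t, x). \<pi> t x" UNIV "\<lambda>x. (t, x)"]
    continuous_on_Pair[OF continuous_on_const continuous_on_id, of UNIV t]
  unfolding semiflow_def by simp

text \<open>At one late index \<open>m\<close>, \<open>\<pi> (t m)\<close> sends \<open>x\<close>
  close to \<open>y\<close>, and sends \<open>z\<close> close to the image of \<open>x' m\<close>,
  which is \<open>y\<close>. The images of \<open>x\<close> and \<open>z\<close> are thus close, and
  the backward modulus makes \<open>x\<close> and \<open>z\<close> close.\<close>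

lemma equicontinuous_imp_aa:
  fixes \<pi> :: "'t::topological_monoid_mult \<Rightarrow> 'x::{uniform_space, t2_space} \<Rightarrow> 'x"
  assumes comp: "compact (UNIV :: 'x set)" and flow: "semiflow \<pi>"
    and surj: "surjective_semiflow \<pi>" and eq: "uniformly_equicontinuous (range \<pi>)"
  shows "aa_point_wrt TYPE('i) \<pi> x"
  unfolding aa_point_wrt_def
proof (intro allI impI)
  fix D :: "'i set" and le t x' y z
  assume dir: "directed_preorder_on D le"
    and lim_t: "((\<lambda>n. \<pi> (t n) x) \<longlongrightarrow> y) (net_filter D le)"
    and lim_x: "(x' \<longlongrightarrow> z) (net_filter D le)"
    and y: "\<forall>n\<in>D. \<pi> (t n) (x' n) = y"
  show "x = z"
  proof (rule entourages_separate)
    fix E :: "('x \<times> 'x) set"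
    assume "E \<in> entourages"
    then obtain B where B: "B \<in> entourages" "\<And>f x y. f \<in> range \<pi> \<Longrightarrow> (f x, f y) \<in> B \<Longrightarrow> (x, y) \<in> E"
      using uniformly_equicontinuous_backward[OF comp eq]
        surj[unfolded surjective_semiflow_def] semiflow_funpow[OF flow] by (smt (verit) image_iff rangeI)
    obtain W where W: "W \<in> entourages" "sym W" "W O W \<subseteq> B"
      using B(1) by (rule entourage_half)
    obtain V where V: "V \<in> entourages" "\<And>t x y. (x, y) \<in> V \<Longrightarrow> (\<pi> t x, \<pi> t y) \<in> W"
      using eq W(1) unfolding uniformly_equicontinuous_def by (metis rangeI)
    have "\<forall>\<^sub>F n in net_filter D le. (y, \<pi> (t n) x) \<in> W \<and> (z, x' n) \<in> V"
      using lim_t lim_x W(1) V(1) by (simp add: tendsto_iff_entourage eventually_conj_iff)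
    then obtain m where "m \<in> D" "\<forall>n\<in>D. le m n \<longrightarrow> (y, \<pi> (t n) x) \<in> W \<and> (z, x' n) \<in> V"
      unfolding eventually_net_filter[OF dir] by blast
    moreover have "le m m"
      using dir \<open>m \<in> D\<close> by (auto simp: directed_preorder_on_def reflp_on_def)
    ultimately have n: "m \<in> D" "(y, \<pi> (t m) x) \<in> W" "(z, x' m) \<in> V"
      by blast+
    then have "(\<pi> (t m) z, y) \<in> W" using V(2) y by metis
    then have "(\<pi> (t m) z, \<pi> (t m) x) \<in> W O W" "(\<pi> (t m) x, \<pi> (t m) z) \<in> W O W"
      using n(2) W(2) by (meson relcompI symD)+
    then show "(x, z) \<in> E" using B(2) W(3) by blast
  qed
qed

text \<open>A finite set witnesses syndeticity: one approximate inverse for a representative of each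
  cell of transitions. The inverse chosen for the cell of \<open>\<pi> t\<close> nearly undoes
  \<open>\<pi> t\<close> as well.\<close>

lemma equicontinuous_imp_ap:
  fixes \<pi> :: "'t::topological_monoid_mult \<Rightarrow> 'x::uniform_space \<Rightarrow> 'x"
  assumes comp: "compact (UNIV :: 'x set)" and flow: "semiflow \<pi>"
    and surj: "surjective_semiflow \<pi>" and eq: "uniformly_equicontinuous (range \<pi>)"
  shows "ap_semiflow \<pi>"
  unfolding ap_semiflow_def
proof
  fix E :: "('x \<times> 'x) set"
  assume "E \<in> entourages"
  then obtain W where W: "W \<in> entourages" "sym W" "W O W \<subseteq> E" by (rule entourage_half)
  obtain V where V: "V \<in> entourages" "\<And>t x y. (x, y) \<in> V \<Longrightarrow> (\<pi> t x, \<pi> t y) \<in> W"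
    using eq W(1) unfolding uniformly_equicontinuous_def by (metis rangeI)
  obtain \<C> where \<C>: "finite \<C>" "range \<pi> \<subseteq> \<Union>\<C>" "\<And>C. C \<in> \<C> \<Longrightarrow> uniformly_small V C"
    using uniformly_equicontinuous_imp_small_cover[OF comp eq V(1)] unfolding small_cover_def by blast
  have "\<exists>k. \<forall>x. (x, \<pi> (t ^ Suc k) x) \<in> W" for t
  proof -
    have "\<pi> t ^^ n \<in> range \<pi>" for n by (simp add: semiflow_funpow[OF flow])
    then obtain k where "\<And>x. (x, (\<pi> t ^^ Suc k) x) \<in> W"
      using uniformly_recurrent[OF uniformly_equicontinuous_imp_small_cover[OF comp eq W(1)], of "\<pi> t"]
        surj unfolding surjective_semiflow_def by metis
    then show ?thesis unfolding semiflow_funpow[OF flow] by blast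
  qed
  then obtain k where k: "\<And>t x. (x, \<pi> (t ^ Suc (k t)) x) \<in> W" by metis
  \<comment> \<open>The choice is arbitrary for a cell without transitions; \<open>r C\<close> is
    used only for the cell of a given \<open>\<pi> t\<close>.\<close>
  define r where "r C = (SOME t. \<pi> t \<in> C)" for C
  \<comment> \<open>With \<open>s = r C\<close>, the power \<open>s ^ Suc (k s)\<close> acts almost
    as the identity, so \<open>s ^ k s\<close> almost inverts \<open>s\<close>.\<close>
  define K where "K = (\<lambda>C. r C ^ k (r C)) ` \<C>"
  define A where "A = {t. \<forall>x. (x, \<pi> t x) \<in> E}"
  have "\<exists>k\<in>K. k * t \<in> A" for t
  proof -
    obtain C where C: "C \<in> \<C>" "\<pi> t \<in> C" using \<C>(2) by blast
    have "\<pi> (r C) \<in> C" unfolding r_def using C(2) by (rule someI)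
    then have "(\<pi> (r C) x, \<pi> t x) \<in> V" for x
      using \<C>(3)[OF C(1)] C(2) unfolding uniformly_small_def by blast
    then have "(\<pi> (r C ^ k (r C)) (\<pi> (r C) x), \<pi> (r C ^ k (r C)) (\<pi> t x)) \<in> W" for x
      by (rule V(2))
    moreover have "\<pi> (s ^ k s) (\<pi> s x) = \<pi> (s ^ Suc (k s)) x" for s x
      using flow unfolding semiflow_def by (metis power_Suc2)
    moreover have "\<pi> (r C ^ k (r C)) (\<pi> t x) = \<pi> (r C ^ k (r C) * t) x" for x
      using flow unfolding semiflow_def by metis
    ultimately have "(x, \<pi> (r C ^ k (r C) * t) x) \<in> W O W" for x
      using k[of x "r C"] by (metis relcompI)
    then have "r C ^ k (r C) * t \<in> A" unfolding A_def using W(3) by blast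
    then show ?thesis unfolding K_def using C(1) by blast
  qed
  moreover have "compact K" unfolding K_def using \<C>(1) by (simp add: finite_imp_compact)
  ultimately have "syndetic A" unfolding syndetic_def by (intro exI[of _ K]) auto
  then show "\<exists>A. syndetic A \<and> (\<forall>x. (\<lambda>t. \<pi> t x) ` A \<subseteq> E `` {x})"
    by (rule_tac exI[of _ A]) (auto simp: A_def)
qed

text \<open>A tube argument: joint continuity gives boxes around the points \<open>(k, x)\<close>,
  finitely many of them cover \<open>K\<close>, and their second factors are intersected.\<close>

lemma compact_transitions_uniformly_equicontinuous:
  fixes \<pi> :: "'t::topological_monoid_mult \<Rightarrow> 'x::uniform_space \<Rightarrow> 'x"
  assumes comp: "compact (UNIV :: 'x set)" and flow: "semiflow \<pi>" and K: "compact K"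
  shows "uniformly_equicontinuous (\<pi> ` K)"
proof (rule uniformly_equicontinuousI[OF comp])
  fix E :: "('x \<times> 'x) set" and x :: 'x
  assume "E \<in> entourages"
  then obtain D where D: "D \<in> entourages" "sym D" "D O D \<subseteq> E" by (rule entourage_half)
  have "\<exists>A B. open A \<and> open B \<and> k \<in> A \<and> x \<in> B \<and> (\<forall>l\<in>A. \<forall>y\<in>B. (\<pi> k x, \<pi> l y) \<in> D)" for k
  proof -
    have "\<forall>\<^sub>F p in nhds (k, x). (\<pi> k x, case p of (l, y) \<Rightarrow> \<pi> l y) \<in> D"
      using semiflow_tendsto[OF flow, of k x] D(1) unfolding tendsto_iff_entourage by blast
    then obtain S where "open S" "(k, x) \<in> S" "\<forall>p\<in>S. (\<pi> k x, case p of (l, y) \<Rightarrow> \<pi> l y) \<in> D"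
      unfolding eventually_nhds by blast
    moreover from this obtain A B where "open A" "open B" "k \<in> A" "x \<in> B" "A \<times> B \<subseteq> S"
      by (metis open_prod_elim mem_Times_iff fst_conv snd_conv)
    ultimately show ?thesis by (intro exI[of _ A] exI[of _ B]) auto
  qed
  then obtain A B where AB: "\<And>k. open (A k)" "\<And>k. open (B k)" "\<And>k. k \<in> A k" "\<And>k. x \<in> B k"
    "\<And>k l y. l \<in> A k \<Longrightarrow> y \<in> B k \<Longrightarrow> (\<pi> k x, \<pi> l y) \<in> D" by metis
  obtain P where P: "finite P" "K \<subseteq> (\<Union>k\<in>P. A k)"
    by (rule compactE_image[OF K, of K A]) (use AB in auto)
  have "open (\<Inter>k\<in>P. B k)" "x \<in> (\<Inter>k\<in>P. B k)" using P(1) AB by auto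
  moreover have "(\<pi> l x, \<pi> l y) \<in> E" if y: "y \<in> (\<Inter>k\<in>P. B k)" and l: "l \<in> K" for l y
  proof -
    obtain k where k: "k \<in> P" "l \<in> A k" using P(2) l by blast
    then have "(\<pi> k x, \<pi> l x) \<in> D" "(\<pi> k x, \<pi> l y) \<in> D" using AB(4,5) y by blast+
    then have "(\<pi> l x, \<pi> l y) \<in> D O D" using D(2) by (meson relcompI symD)
    then show ?thesis using D(3) by blast
  qed
  ultimately show "\<forall>\<^sub>F y in nhds x. \<forall>f\<in>\<pi> ` K. (f x, f y) \<in> E"
    unfolding eventually_nhds by blast
qed

text \<open>Syndeticity puts some \<open>k * t\<close> into \<open>A\<close>, so
  \<open>\<pi> (k * t)\<close> moves \<open>x\<close> and \<open>y\<close> only slightly; yet it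
  sends both to the same point when \<open>\<pi> t\<close> does.\<close>

lemma ap_imp_injective:
  fixes \<pi> :: "'t::topological_monoid_mult \<Rightarrow> 'x::{uniform_space, t2_space} \<Rightarrow> 'x"
  assumes flow: "semiflow \<pi>" and ap: "ap_semiflow \<pi>"
  shows "inj (\<pi> t)"
proof (rule injI, rule entourages_separate)
  fix x y and E :: "('x \<times> 'x) set"
  assume eq: "\<pi> t x = \<pi> t y" and "E \<in> entourages"
  then obtain D where D: "D \<in> entourages" "sym D" "D O D \<subseteq> E" by (metis entourage_half)
  obtain A where A: "syndetic A" "\<And>x. (\<lambda>t. \<pi> t x) ` A \<subseteq> D `` {x}"
    using ap D(1) unfolding ap_semiflow_def by blast
  obtain k where "k * t \<in> A" using A(1) unfolding syndetic_def by blast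
  then have "(x, \<pi> (k * t) x) \<in> D" "(y, \<pi> (k * t) y) \<in> D" using A(2) by blast+
  moreover have "\<pi> (k * t) x = \<pi> (k * t) y" using flow eq unfolding semiflow_def by metis
  ultimately have "(x, y) \<in> D O D" using D(2) by (metis relcompI symD)
  then show "(x, y) \<in> E" using D(3) by blast
qed

text \<open>Since \<open>k * t \<in> A\<close> makes \<open>\<pi> k\<close> an approximate inverse of \<open>\<pi> t\<close>, almost periodicity yields
  directly the equicontinuity of the inverses; recurrence turns this into that of the maps.\<close>

lemma ap_imp_uniformly_equicontinuous:
  fixes \<pi> :: "'t::topological_monoid_mult \<Rightarrow> 'x::uniform_space \<Rightarrow> 'x"
  assumes comp: "compact (UNIV :: 'x set)" and flow: "semiflow \<pi>" and ap: "ap_semiflow \<pi>"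
    and bij: "\<And>t. bij (\<pi> t)"
  shows "uniformly_equicontinuous (range \<pi>)"
proof -
  define F where "F = range (\<lambda>t. inv (\<pi> t))"
  have "uniformly_equicontinuous F"
    unfolding uniformly_equicontinuous_def
  proof
    fix E :: "('x \<times> 'x) set"
    assume "E \<in> entourages"
    then obtain D where D: "D \<in> entourages" "sym D" "D O D O D \<subseteq> E" by (rule entourage_quarter)
    obtain A where A: "syndetic A" "\<And>x. (\<lambda>t. \<pi> t x) ` A \<subseteq> D `` {x}"
      using ap D(1) unfolding ap_semiflow_def by blast
    obtain K where K: "compact K" "\<And>t. \<exists>k\<in>K. k * t \<in> A" using A(1) unfolding syndetic_def by blast
    obtain V where V: "V \<in> entourages" "\<And>k x y. k \<in> K \<Longrightarrow> (x, y) \<in> V \<Longrightarrow> (\<pi> k x, \<pi> k y) \<in> D"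
      using compact_transitions_uniformly_equicontinuous[OF comp flow K(1)] D(1)
      unfolding uniformly_equicontinuous_def by (metis image_eqI)
    have "(inv (\<pi> t) x, inv (\<pi> t) y) \<in> E" if xy: "(x, y) \<in> V" for t x y
    proof -
      obtain k where k: "k \<in> K" "k * t \<in> A" using K(2) by blast
      \<comment> \<open>For \<open>w = inv (\<pi> t) z\<close>, the point \<open>\<pi> k z\<close>
        is \<open>\<pi> (k * t) w\<close>. As \<open>V\<close> depends on \<open>K\<close> only, it
        is a modulus for all inverses at once.\<close>
      have "(inv (\<pi> t) z, \<pi> k z) \<in> D" for z
      proof -
        have "\<pi> (k * t) (inv (\<pi> t) z) = \<pi> k (\<pi> t (inv (\<pi> t) z))"
          using flow unfolding semiflow_def by metis
        also have "\<dots> = \<pi> k z" using bij by (simp add: bij_is_surj surj_f_inv_f)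
        finally show ?thesis using A(2)[of "inv (\<pi> t) z"] k(2) by auto
      qed
      then have "(inv (\<pi> t) x, inv (\<pi> t) y) \<in> D O D O D"
        using V(2)[OF k(1) xy] D(2) by (meson relcompI symD)
      then show ?thesis using D(3) by blast
    qed
    then show "\<exists>D\<in>entourages. \<forall>f\<in>F. \<forall>x y. (x, y) \<in> D \<longrightarrow> (f x, f y) \<in> E"
      using V(1) unfolding F_def by (intro bexI[of _ V]) auto
  qed
  moreover have "surj f" if "f \<in> F" for f
    using that bij unfolding F_def by (auto simp: bij_imp_bij_inv bij_is_surj)
  moreover have "f ^^ n \<in> F" if f: "f \<in> F" for f and n :: nat
  proof -
    obtain t where "f = inv (\<pi> t)" using f unfolding F_def by blast
    then have "f ^^ n = inv (\<pi> (t ^ n))"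
      using inv_fn[of "\<pi> t" n, OF bij] by (simp add: semiflow_funpow[OF flow])
    then show ?thesis unfolding F_def by blast
  qed
  ultimately have backward: "\<exists>D\<in>entourages. \<forall>f\<in>F. \<forall>x y. (f x, f y) \<in> D \<longrightarrow> (x, y) \<in> E"
    if E: "E \<in> entourages" for E
    using uniformly_equicontinuous_backward[OF comp _ _ _ E, of F] by metis
  show ?thesis
    unfolding uniformly_equicontinuous_def
  proof
    fix E :: "('x \<times> 'x) set"
    assume "E \<in> entourages"
    from backward[OF this] obtain D where
      D: "D \<in> entourages" "\<And>t x y. (inv (\<pi> t) x, inv (\<pi> t) y) \<in> D \<Longrightarrow> (x, y) \<in> E"
      unfolding F_def by blast
    \<comment> \<open>The backward modulus of the inverses is a forward modulus of the maps, since
      \<open>x\<close> is the preimage of \<open>\<pi> t x\<close>.\<close>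
    have "(\<pi> t x, \<pi> t y) \<in> E" if "(x, y) \<in> D" for t x y
      using D(2)[of t "\<pi> t x" "\<pi> t y"] that bij by (simp add: bij_is_inj)
    then show "\<exists>D\<in>entourages. \<forall>f\<in>range \<pi>. \<forall>x y. (x, y) \<in> D \<longrightarrow> (f x, f y) \<in> E"
      using D(1) by (intro bexI[of _ D]) auto
  qed
qed

section \<open>Compact semigroups of maps\<close>

lemma continuous_precompose:
  "continuous_on UNIV (\<lambda>q :: 'b \<Rightarrow> 'c::topological_space. q \<circ> p)"
  unfolding comp_def by (intro continuous_on_coordinatewise_then_product continuous_on_product_coordinates)

lemma compact_precompose:
  fixes M :: "('b \<Rightarrow> 'c::topological_space) set"
  assumes "compact M"
  shows "compact ((\<lambda>q. q \<circ> p) ` M)"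
  by (rule compact_continuous_image[OF _ assms], rule continuous_on_subset, rule continuous_precompose) simp

lemma continuous_postcompose:
  assumes "continuous_on UNIV s"
  shows "continuous_on UNIV (\<lambda>q :: 'b \<Rightarrow> 'c::topological_space. s \<circ> q)"
  unfolding comp_def
  by (intro continuous_on_coordinatewise_then_product
      continuous_on_compose2[OF assms continuous_on_product_coordinates] subset_UNIV)

lemma closed_fun_fixed:
  fixes p :: "'a \<Rightarrow> 'b::t2_space" and \<phi> :: "('a \<Rightarrow> 'b) \<Rightarrow> 'a \<Rightarrow> 'b"
  assumes "continuous_on UNIV \<phi>"
  shows "closed {q. \<phi> q = p}"
proof -
  have "closed (\<phi> -` {p})"
    by (rule closed_vimage[OF compact_imp_closed_fun assms]) simp
  then show ?thesis by (simp add: vimage_def)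
qed

text \<open>The Ellis--Numakura lemma: a minimal closed subsemigroup \<open>M\<close> satisfies \<open>M p = M\<close> for
  \<open>p \<in> M\<close>, so \<open>{q \<in> M. q p = p}\<close> is again a closed subsemigroup and hence contains \<open>p\<close>.\<close>

lemma exists_idempotent:
  fixes A :: "('a \<Rightarrow> 'a::t2_space) set"
  assumes "compact A" "A \<noteq> {}" "\<And>p q. p \<in> A \<Longrightarrow> q \<in> A \<Longrightarrow> p \<circ> q \<in> A"
  shows "\<exists>u\<in>A. u \<circ> u = u"
proof -
  define \<S> where "\<S> = {B. B \<subseteq> A \<and> compact B \<and> B \<noteq> {} \<and> (\<forall>p\<in>B. \<forall>q\<in>B. p \<circ> q \<in> B)}"
  have "\<exists>M\<in>\<S>. \<forall>B\<in>\<S>. B \<subseteq> M \<longrightarrow> B = M"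
  \<comment> \<open>The order is reversed inclusion, so a maximal element is a minimal
    subsemigroup.\<close>
  proof (rule predicate_Zorn[of \<S> "\<lambda>B C. C \<subseteq> B"])
    show "partial_order_on \<S> (relation_of (\<lambda>B C. C \<subseteq> B) \<S>)"
      by (rule partial_order_on_relation_ofI) auto
    fix \<C> assume "\<C> \<in> Chains (relation_of (\<lambda>B C. C \<subseteq> B) \<S>)"
    then have chain: "\<C> \<subseteq> \<S>" "\<And>B C. B \<in> \<C> \<Longrightarrow> C \<in> \<C> \<Longrightarrow> B \<subseteq> C \<or> C \<subseteq> B"
      unfolding Chains_def relation_of_def by auto
    have closed: "closed B" if "B \<in> \<C>" for B
      using chain(1) that unfolding \<S>_def by (intro compact_imp_closed_fun) auto
    \<comment> \<open>Intersecting with \<open>A\<close> gives the empty chain the bound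
      \<open>A\<close>.\<close>
    have "A \<inter> \<Inter>\<C> \<noteq> {}"
    proof (rule compact_imp_fip[OF assms(1) closed])
      fix \<F> assume \<F>: "finite \<F>" "\<F> \<subseteq> \<C>"
      show "A \<inter> \<Inter>\<F> \<noteq> {}"
      proof (cases "\<F> = {}")
        case True then show ?thesis using assms(2) by simp
      next
        case False
        obtain m where m: "m \<in> \<F>" "\<And>b. b \<in> \<F> \<Longrightarrow> b \<subseteq> m \<Longrightarrow> m = b"
          using finite_has_minimal[OF \<F>(1) False] by blast
        then have "m \<subseteq> \<Inter>\<F>" using chain(2) \<F>(2) by (metis Inter_greatest subsetD subset_refl)
        moreover have "m \<in> \<S>" using m(1) \<F>(2) chain(1) by blast
        ultimately show ?thesis unfolding \<S>_def by blast
      qed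
    qed
    moreover have "compact (A \<inter> \<Inter>\<C>)"
      using assms(1) closed by (intro compact_Int_closed closed_Inter) auto
    moreover have "p \<circ> q \<in> A \<inter> \<Inter>\<C>" if "p \<in> A \<inter> \<Inter>\<C>" "q \<in> A \<inter> \<Inter>\<C>" for p q
      using that chain(1) assms(3) unfolding \<S>_def by blast
    ultimately show "\<exists>u\<in>\<S>. \<forall>B\<in>\<C>. u \<subseteq> B"
      by (intro bexI[of _ "A \<inter> \<Inter>\<C>"]) (auto simp: \<S>_def)
  qed
  then obtain M where M: "M \<in> \<S>" "\<And>B. B \<in> \<S> \<Longrightarrow> B \<subseteq> M \<Longrightarrow> M = B" by blast
  obtain p where p: "p \<in> M" using M(1) unfolding \<S>_def by blast
  have mult: "q \<circ> r \<in> M" if "q \<in> M" "r \<in> M" for q r using that M(1) unfolding \<S>_def by blast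
  have cM: "compact M" "M \<subseteq> A" using M(1) unfolding \<S>_def by blast+
  define L where "L = (\<lambda>q. q \<circ> p) ` M"
  have "compact L" unfolding L_def
    by (rule compact_precompose[OF cM(1)])
  moreover have LM: "L \<subseteq> M" unfolding L_def using mult p by blast
  moreover have "q \<circ> r \<in> L" if qr: "q \<in> L" "r \<in> L" for q r
  proof -
    obtain r' where r': "r' \<in> M" "r = r' \<circ> p" using qr(2) unfolding L_def by blast
    then have "q \<circ> r = (q \<circ> r') \<circ> p" by (simp add: comp_assoc)
    moreover have "q \<circ> r' \<in> M" using mult LM qr(1) r'(1) by blast
    ultimately show ?thesis unfolding L_def by blast
  qed
  ultimately have "L \<in> \<S>" using cM(2) p unfolding \<S>_def L_def by auto
  then have "M = L" using M(2) LM by blast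
  define S where "S = M \<inter> {q. q \<circ> p = p}"
  have "p \<in> L" using p \<open>M = L\<close> by simp
  then obtain q where "p = q \<circ> p" "q \<in> M" unfolding L_def by (rule imageE)
  then have "S \<noteq> {}" unfolding S_def by auto
  moreover have "compact S" unfolding S_def
    by (rule compact_Int_closed[OF cM(1) closed_fun_fixed[OF continuous_precompose]])
  moreover have "q \<circ> r \<in> S" if "q \<in> S" "r \<in> S" for q r
    using that mult unfolding S_def by (auto simp: comp_assoc)
  ultimately have "S \<in> \<S>" using cM(2) unfolding \<S>_def S_def by blast
  then have "p \<in> S" using M(2) p unfolding S_def by blast
  then show ?thesis using p cM(2) unfolding S_def by blast
qed

text \<open>An injective idempotent is the identity. Each left ideal \<open>G \<circ> p\<close> is a
  compact semigroup, hence contains an idempotent, that is \<open>id\<close>, which yields a left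
  inverse of \<open>p\<close> in \<open>G\<close>.\<close>

lemma injective_compact_semigroup_is_group:
  fixes G :: "('a \<Rightarrow> 'a::t2_space) set"
  assumes "compact G" "G \<noteq> {}" and mult: "\<And>p q. p \<in> G \<Longrightarrow> q \<in> G \<Longrightarrow> p \<circ> q \<in> G"
    and inj: "\<And>p. p \<in> G \<Longrightarrow> inj p" and p: "p \<in> G"
  shows "bij p \<and> inv p \<in> G"
proof -
  have idem: "u = id" if "u \<in> G" "u \<circ> u = u" for u
  proof
    fix x
    have "u (u x) = u x" using that(2) by (metis comp_apply)
    then show "u x = id x" using inj[OF that(1)] by (simp add: inj_eq)
  qed
  have left: "\<exists>r\<in>G. r \<circ> p = id" if p: "p \<in> G" for p
  proof -
    define L where "L = (\<lambda>q. q \<circ> p) ` G"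
    have "compact L" unfolding L_def
      by (rule compact_precompose[OF assms(1)])
    moreover have "L \<noteq> {}" using assms(2) unfolding L_def by simp
    moreover have LG: "L \<subseteq> G" unfolding L_def using mult p by blast
    moreover have "q \<circ> r \<in> L" if qr: "q \<in> L" "r \<in> L" for q r
    proof -
      obtain r' where r': "r' \<in> G" "r = r' \<circ> p" using qr(2) unfolding L_def by blast
      then have "q \<circ> r = (q \<circ> r') \<circ> p" by (simp add: comp_assoc)
      moreover have "q \<circ> r' \<in> G" using mult LG qr(1) r'(1) by blast
      ultimately show ?thesis unfolding L_def by blast
    qed
    ultimately obtain u where "u \<in> L" "u \<circ> u = u" using exists_idempotent by blast
    then have "id \<in> L" using idem LG by blast
    then obtain r where "id = r \<circ> p" "r \<in> G" unfolding L_def by (rule imageE)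
    then show ?thesis by metis
  qed
  obtain r where r: "r \<in> G" "r \<circ> p = id" using left[OF p] by blast
  obtain s where s: "s \<in> G" "s \<circ> r = id" using left[OF r(1)] by blast
  \<comment> \<open>The left inverse \<open>s\<close> of the left inverse \<open>r\<close> is
    \<open>p\<close> itself, so \<open>r\<close> is two-sided.\<close>
  have "s = s \<circ> (r \<circ> p)" using r(2) by simp
  also have "\<dots> = p" using s(2) by (simp add: comp_assoc[symmetric])
  finally have "p \<circ> r = id" using s(2) by simp
  then have "bij p" "inv p = r" using r(2) by (auto intro: o_bij inv_unique_comp)
  then show ?thesis using r(1) by simp
qed

text \<open>The limits are taken in order: first in \<open>q\<close> for a fixed continuous
  \<open>s\<close>, then in \<open>p\<close>, since precomposition with any \<open>q\<close> is
  continuous while postcomposition calls for a continuous map.\<close>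

lemma closure_closed_under_comp:
  fixes S :: "('a::topological_space \<Rightarrow> 'a) set"
  assumes cont: "\<And>s. s \<in> S \<Longrightarrow> continuous_on UNIV s"
    and mult: "\<And>s t. s \<in> S \<Longrightarrow> t \<in> S \<Longrightarrow> s \<circ> t \<in> S"
    and p: "p \<in> closure S" and q: "q \<in> closure S"
  shows "p \<circ> q \<in> closure S"
proof -
  have *: "s \<circ> q \<in> closure S" if s: "s \<in> S" for s
  proof -
    have "closed ((\<lambda>q. s \<circ> q) -` closure S)"
      by (rule closed_vimage[OF closed_closure continuous_postcompose[OF cont[OF s]]])
    moreover have "S \<subseteq> (\<lambda>q. s \<circ> q) -` closure S" using mult[OF s] closure_subset by blast
    ultimately show ?thesis using q closure_minimal by blast
  qed
  have "closed ((\<lambda>p. p \<circ> q) -` closure S)"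
    by (rule closed_vimage[OF closed_closure continuous_precompose])
  moreover have "S \<subseteq> (\<lambda>p. p \<circ> q) -` closure S" using * by blast
  ultimately show ?thesis using p closure_minimal by blast
qed

section \<open>The enveloping group\<close>

text \<open>A proper filter is turned into a net: the indices are pairs \<open>(A, t)\<close> of an
  eventual set and a point of it, ordered by reversed inclusion of the sets.\<close>

lemma aa_point_filter:
  fixes \<pi> :: "'t \<Rightarrow> 'x::topological_space \<Rightarrow> 'x"
  assumes x: "x \<in> P_aa \<pi>" and F: "F \<noteq> bot"
    and lim: "((\<lambda>t. \<pi> t x) \<longlongrightarrow> y) F" "(x' \<longlongrightarrow> z) F" and y: "\<And>t. \<pi> t (x' t) = y"
  shows "x = z"
proof -
  define D where "D = {(A, t). eventually (\<lambda>t. t \<in> A) F \<and> t \<in> A}"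
  define le :: "'t set \<times> 't \<Rightarrow> 't set \<times> 't \<Rightarrow> bool" where "le a b \<longleftrightarrow> fst b \<subseteq> fst a" for a b
  have mem: "\<exists>t. (A, t) \<in> D" if "eventually (\<lambda>t. t \<in> A) F" for A
    using that eventually_happens'[OF F that] unfolding D_def by auto
  have dir: "directed_preorder_on D le"
    unfolding directed_preorder_on_def
  proof (intro conjI ballI)
    show "D \<noteq> {}" using mem[of UNIV] by auto
    show "reflp_on D le" "transp_on D le" by (auto simp: le_def reflp_on_def transp_on_def)
    fix a b assume "a \<in> D" "b \<in> D"
    then have "eventually (\<lambda>t. t \<in> fst a \<inter> fst b) F" by (auto simp: D_def eventually_conj_iff)
    then obtain t where "(fst a \<inter> fst b, t) \<in> D" using mem by blast
    then show "\<exists>c\<in>D. le a c \<and> le b c" by (intro bexI[of _ "(fst a \<inter> fst b, t)"]) (auto simp: le_def)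
  qed
  have "filterlim snd F (net_filter D le)"
    unfolding filterlim_iff
  proof (intro allI impI)
    fix P assume "eventually P F"
    then have P: "eventually (\<lambda>t. t \<in> {t. P t}) F" by simp
    then obtain t where t: "({t. P t}, t) \<in> D" using mem by blast
    have "P (snd m)" if "m \<in> D" "le ({t. P t}, t) m" for m
      using that by (auto simp: D_def le_def)
    then show "\<forall>\<^sub>F i in net_filter D le. P (snd i)"
      unfolding eventually_net_filter[OF dir] using t by blast
  qed
  then have "((\<lambda>i. \<pi> (snd i) x) \<longlongrightarrow> y) (net_filter D le)" "((\<lambda>i. x' (snd i)) \<longlongrightarrow> z) (net_filter D le)"
    using lim by (auto intro: filterlim_compose)
  then show ?thesis
    using P_aa_all_nets[OF x, where 'i = "'t set \<times> 't"] dir y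
    unfolding aa_point_wrt_def by metis
qed

text \<open>Otherwise compactness gives the preimages of \<open>y\<close> a cluster point
  \<open>z\<close> outside a neighbourhood of \<open>x\<close>. On a finer filter they converge to
  \<open>z\<close>, and almost automorphy forces \<open>x = z\<close>.\<close>

lemma aa_tendsto_inv:
  fixes \<pi> :: "'t \<Rightarrow> 'x::topological_space \<Rightarrow> 'x"
  assumes comp: "compact (UNIV :: 'x set)" and x: "x \<in> P_aa \<pi>" and bij: "\<And>t. bij (\<pi> t)"
    and lim: "((\<lambda>t. \<pi> t x) \<longlongrightarrow> y) F"
  shows "((\<lambda>t. inv (\<pi> t) y) \<longlongrightarrow> x) F"
proof (rule ccontr)
  define f where "f = (\<lambda>t. inv (\<pi> t) y)"
  assume "\<not> ((\<lambda>t. inv (\<pi> t) y) \<longlongrightarrow> x) F"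
  then obtain W where W: "open W" "x \<in> W" "\<not> eventually (\<lambda>t. f t \<in> W) F"
    unfolding tendsto_def f_def by blast
  \<comment> \<open>\<open>G\<close> retains the indices whose preimage avoids
    \<open>W\<close>.\<close>
  define G where "G = inf F (principal {t. f t \<notin> W})"
  have "G \<noteq> bot"
    using W(3) unfolding G_def trivial_limit_def eventually_inf_principal by simp
  then have "filtermap f G \<noteq> bot" by (simp add: filtermap_bot_iff)
  moreover have "eventually (\<lambda>z. z \<in> - W) (filtermap f G)"
    unfolding eventually_filtermap G_def eventually_inf_principal by simp
  moreover have "compact (- W)"
    using compact_Int_closed[OF comp closed_Compl[OF W(1)]] by simp
  ultimately obtain z where z: "z \<in> - W" "inf (nhds z) (filtermap f G) \<noteq> bot"
    unfolding compact_filter by blast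
  \<comment> \<open>\<open>H\<close> refines \<open>G\<close> so that \<open>f\<close> converges to
    \<open>z\<close>; it is proper because \<open>z\<close> is a cluster point of \<open>f\<close>
    along \<open>G\<close>.\<close>
  define H where "H = inf G (filtercomap f (nhds z))"
  have "H \<noteq> bot"
  proof
    assume "H = bot"
    then obtain P Q where PQ: "eventually P G" "eventually Q (filtercomap f (nhds z))" "\<And>t. P t \<and> Q t \<Longrightarrow> False"
      unfolding H_def trivial_limit_def eventually_inf by blast
    obtain R where R: "eventually R (nhds z)" "\<And>t. R (f t) \<Longrightarrow> Q t"
      using PQ(2) unfolding eventually_filtercomap by blast
    have "eventually (\<lambda>z. \<not> R z) (filtermap f G)"
      unfolding eventually_filtermap using PQ(1) by (rule eventually_mono) (use PQ(3) R(2) in blast)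
    then have "eventually (\<lambda>_. False) (inf (nhds z) (filtermap f G))"
      using R(1) unfolding eventually_inf by blast
    then show False using z(2) unfolding trivial_limit_def by blast
  qed
  moreover have "((\<lambda>t. \<pi> t x) \<longlongrightarrow> y) H"
    by (rule tendsto_mono[OF _ lim]) (simp add: H_def G_def le_infI1)
  moreover have "(f \<longlongrightarrow> z) H"
    using filterlim_filtercomap by (rule filterlim_mono[OF _ order_refl]) (simp add: H_def)
  moreover have "\<pi> t (f t) = y" for t
    unfolding f_def using bij by (simp add: bij_is_surj surj_f_inv_f)
  ultimately have "x = z" using aa_point_filter[OF x] by blast
  then show False using z(1) W(2) by blast
qed

text \<open>This filter plays the role of a net of indices \<open>t\<close> along which
  \<open>f t\<close> tends to \<open>p\<close>.\<close>

lemma filtercomap_nhds_neq_bot: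
  assumes "p \<in> closure (range f)"
  shows "filtercomap f (nhds p) \<noteq> bot"
proof
  assume "filtercomap f (nhds p) = bot"
  then obtain R where R: "eventually R (nhds p)" "\<And>t. \<not> R (f t)"
    unfolding trivial_limit_def eventually_filtercomap by blast
  then obtain N where "open N" "p \<in> N" "\<forall>q\<in>N. R q" unfolding eventually_nhds by blast
  then show False using assms R(2) open_Int_closure_eq_empty[of N "range f"] by blast
qed

lemma tendsto_filtercomap_apply:
  fixes f :: "'t \<Rightarrow> 'a \<Rightarrow> 'b::topological_space"
  shows "((\<lambda>t. f t x) \<longlongrightarrow> p x) (filtercomap f (nhds p))"
proof -
  have "continuous_on UNIV (\<lambda>q::'a \<Rightarrow> 'b. q x)" by (rule continuous_on_product_coordinates)
  then have "((\<lambda>q. q x) \<longlongrightarrow> p x) (nhds p)"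
    using tendsto_at_iff_tendsto_nhds[of "\<lambda>q. q x" p] by (simp add: continuous_on_def)
  then show ?thesis by (rule filterlim_compose[OF _ filterlim_filtercomap])
qed

text \<open>A continuous map from a compact space onto a Hausdorff space is closed, so the preimage
  of a closed set under \<open>g\<close> is the closed image of its preimage in
  \<open>K\<close>.\<close>

lemma compact_quotient_continuous:
  fixes e :: "'a::topological_space \<Rightarrow> 'b::t2_space" and g :: "'b \<Rightarrow> 'c::topological_space"
  assumes "compact K" "continuous_on K e" "e ` K = UNIV" "continuous_on K (\<lambda>x. g (e x))" and K: "closed K"
  shows "continuous_on UNIV g"
  unfolding continuous_on_closed_vimage[OF closed_UNIV]
proof (intro allI impI)
  fix C :: "'c set"
  assume "closed C"
  then have "closed ((\<lambda>x. g (e x)) -` C \<inter> K)"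
    using assms(4) continuous_on_closed_vimage[OF K] by blast
  then have "compact (K \<inter> ((\<lambda>x. g (e x)) -` C \<inter> K))"
    by (rule compact_Int_closed[OF assms(1)])
  moreover have "K \<inter> ((\<lambda>x. g (e x)) -` C \<inter> K) = {x \<in> K. g (e x) \<in> C}" by auto
  ultimately have "compact {x \<in> K. g (e x) \<in> C}" by simp
  then have "compact (e ` {x \<in> K. g (e x) \<in> C})"
    by (intro compact_continuous_image continuous_on_subset[OF assms(2)]) auto
  moreover have "y \<in> e ` {x \<in> K. g (e x) \<in> C}" if y: "g y \<in> C" for y
  proof -
    have "y \<in> e ` K" using assms(3) by simp
    then show ?thesis using y by auto
  qed
  then have "e ` {x \<in> K. g (e x) \<in> C} = g -` C \<inter> UNIV" by auto
  ultimately show "closed (g -` C \<inter> UNIV)" using compact_imp_closed by metis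
qed

context
  fixes \<pi> :: "'t::topological_monoid_mult \<Rightarrow> 'x::{uniform_space, t2_space} \<Rightarrow> 'x"
  assumes comp: "compact (UNIV :: 'x set)" and flow: "semiflow \<pi>"
    and bij: "\<And>t. bij (\<pi> t)" and aa: "P_aa \<pi> = UNIV"
begin

lemma enveloping_compact: "compact (closure (range \<pi>))"
  using compact_Int_closed[OF compact_UNIV_fun[OF comp] closed_closure] by simp

lemma enveloping_comp:
  "p \<in> closure (range \<pi>) \<Longrightarrow> q \<in> closure (range \<pi>) \<Longrightarrow> p \<circ> q \<in> closure (range \<pi>)"
  by (rule closure_closed_under_comp) (auto simp: semiflow_comp[OF flow] semiflow_continuous[OF flow])

lemma tendsto_inv_enveloping:
  "((\<lambda>t. inv (\<pi> t) (p x)) \<longlongrightarrow> x) (filtercomap \<pi> (nhds p))"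
  by (rule aa_tendsto_inv[OF comp _ bij]) (simp_all add: aa tendsto_filtercomap_apply)

text \<open>If \<open>p x = p y\<close>, the same preimages converge to both \<open>x\<close> and
  \<open>y\<close> along a proper filter.\<close>

lemma enveloping_inj:
  assumes "p \<in> closure (range \<pi>)"
  shows "inj p"
proof (rule injI)
  fix x y assume "p x = p y"
  then have "((\<lambda>t. inv (\<pi> t) (p x)) \<longlongrightarrow> y) (filtercomap \<pi> (nhds p))"
    using tendsto_inv_enveloping[of p y] by simp
  then show "x = y"
    using tendsto_unique[OF filtercomap_nhds_neq_bot[OF assms] tendsto_inv_enveloping] by blast
qed

lemma enveloping_group:
  assumes "p \<in> closure (range \<pi>)"
  shows "bij p" "inv p \<in> closure (range \<pi>)"
  using injective_compact_semigroup_is_group[OF enveloping_compact _ enveloping_comp enveloping_inj assms] assms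
  by blast+

text \<open>Almost automorphy controls \<open>inv\<close> only along transitions approaching a
  limit. To compare \<open>p\<close> with a nearby limit \<open>r\<close>, a transition inside the
  neighbourhood \<open>N\<close> of \<open>p\<close> and close to \<open>r\<close> is
  interposed.\<close>

lemma enveloping_inv_continuous: "continuous_on (closure (range \<pi>)) inv"
proof (rule continuous_on_coordinatewise_then_product)
  fix y
  show "continuous_on (closure (range \<pi>)) (\<lambda>p. inv p y)"
    unfolding continuous_on_def tendsto_iff_entourage
  proof (intro ballI)
    fix p and E :: "('x \<times> 'x) set"
    assume p: "p \<in> closure (range \<pi>)" and "E \<in> entourages"
    then obtain D where D: "D \<in> entourages" "sym D" "D O D \<subseteq> E" by (metis entourage_half)
    have lim: "((\<lambda>t. inv (\<pi> t) y) \<longlongrightarrow> inv r y) (filtercomap \<pi> (nhds r))" if r: "r \<in> closure (range \<pi>)" for r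
      using tendsto_inv_enveloping[of r "inv r y"] enveloping_group(1)[OF r]
      by (simp add: bij_is_surj surj_f_inv_f)
    have "\<forall>\<^sub>F t in filtercomap \<pi> (nhds p). (inv p y, inv (\<pi> t) y) \<in> D"
      using lim[OF p] D(1) unfolding tendsto_iff_entourage by blast
    then obtain R where R: "eventually R (nhds p)" "\<And>t. R (\<pi> t) \<Longrightarrow> (inv p y, inv (\<pi> t) y) \<in> D"
      unfolding eventually_filtercomap by blast
    then obtain N where N: "open N" "p \<in> N" "\<And>q. q \<in> N \<Longrightarrow> R q" unfolding eventually_nhds by blast
    have "(inv p y, inv r y) \<in> E" if r: "r \<in> N" "r \<in> closure (range \<pi>)" for r
    proof -
      have "\<forall>\<^sub>F q in nhds r. q \<in> N" using N(1) r(1) by (rule eventually_nhds_in_open)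
      then have "\<forall>\<^sub>F t in filtercomap \<pi> (nhds r). \<pi> t \<in> N" by (rule eventually_filtercomapI)
      moreover have "\<forall>\<^sub>F t in filtercomap \<pi> (nhds r). (inv r y, inv (\<pi> t) y) \<in> D"
        using lim[OF r(2)] D(1) unfolding tendsto_iff_entourage by blast
      ultimately have "\<forall>\<^sub>F t in filtercomap \<pi> (nhds r). \<pi> t \<in> N \<and> (inv r y, inv (\<pi> t) y) \<in> D"
        by (rule eventually_conj)
      then obtain t where "\<pi> t \<in> N" "(inv r y, inv (\<pi> t) y) \<in> D"
        using eventually_happens'[OF filtercomap_nhds_neq_bot[OF r(2)]] by blast
      then have "(inv p y, inv r y) \<in> D O D" using R(2) N(3) D(2) by (meson relcompI symD)
      then show ?thesis using D(3) by blast
    qed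
    then show "\<forall>\<^sub>F r in at p within closure (range \<pi>). (inv p y, inv r y) \<in> E"
      unfolding eventually_at_topological using N(1,2) by blast
  qed
qed

text \<open>Left multiplication by \<open>p\<close> is \<open>r \<mapsto> (r\<^sup>-\<^sup>1 p\<^sup>-\<^sup>1)\<^sup>-\<^sup>1\<close>, hence continuous on the enveloping group,
  and by minimality \<open>X\<close> is a quotient of that group.\<close>

lemma enveloping_continuous:
  assumes minimal: "minimal_semiflow \<pi>" and p: "p \<in> closure (range \<pi>)"
  shows "continuous_on UNIV p"
proof (rule compact_quotient_continuous[OF enveloping_compact])
  let ?E = "closure (range \<pi>)"
  fix x0 :: 'x
  show ev: "continuous_on ?E (\<lambda>r. r x0)"
    by (rule continuous_on_subset[OF continuous_on_product_coordinates]) simp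
  \<comment> \<open>Evaluation at \<open>x0\<close> has a closed image containing the dense orbit of
    \<open>x0\<close>, so it is onto.\<close>
  have "closed ((\<lambda>r. r x0) ` ?E)"
    by (rule compact_imp_closed[OF compact_continuous_image[OF ev enveloping_compact]])
  moreover have "range (\<lambda>t. \<pi> t x0) \<subseteq> (\<lambda>r. r x0) ` ?E"
    using closure_subset by blast
  ultimately have "closure (range (\<lambda>t. \<pi> t x0)) \<subseteq> (\<lambda>r. r x0) ` ?E"
    by (simp add: closure_minimal)
  then show "(\<lambda>r. r x0) ` ?E = UNIV"
    using minimal unfolding minimal_semiflow_def by blast
  have cont: "continuous_on ?E (\<lambda>r. inv (inv r \<circ> inv p))"
  proof (rule continuous_on_compose2[OF enveloping_inv_continuous])
    show "continuous_on ?E (\<lambda>r. inv r \<circ> inv p)"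
      by (rule continuous_on_compose2[OF continuous_precompose enveloping_inv_continuous]) simp
    show "(\<lambda>r. inv r \<circ> inv p) ` ?E \<subseteq> ?E"
      using enveloping_comp enveloping_group(2) p by blast
  qed
  have "continuous_on ?E (\<lambda>r. inv (inv r \<circ> inv p) x0)"
    by (rule continuous_on_product_then_coordinatewise[OF cont])
  moreover have "inv (inv r \<circ> inv p) = p \<circ> r" if r: "r \<in> ?E" for r
    using enveloping_group(1)[OF r] enveloping_group(1)[OF p]
    by (metis bij_imp_bij_inv inv_inv_eq o_inv_distrib)
  ultimately show "continuous_on ?E (\<lambda>r. p (r x0))"
    by (simp cong: continuous_on_cong)
  show "closed ?E" by simp
qed

end

section \<open>Total boundedness by Baire category\<close>

lemma closure_eventually_ex:
  assumes "p \<in> closure S" "eventually P (nhds p)"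
  shows "\<exists>s\<in>S. P s"
proof -
  obtain N where "open N" "p \<in> N" "\<forall>q\<in>N. P q" using assms(2) unfolding eventually_nhds by blast
  then show ?thesis using assms(1) open_Int_closure_eq_empty[of N S] by blast
qed

lemma eventually_nhds_apply:
  fixes p :: "'b \<Rightarrow> 'a::uniform_space"
  assumes "E \<in> entourages"
  shows "\<forall>\<^sub>F q in nhds p. (p x, q x) \<in> E"
  by (rule continuous_entourage[OF continuous_on_product_coordinates assms])

lemma uniformly_small_closure:
  fixes C :: "('b \<Rightarrow> 'a::uniform_space) set"
  assumes C: "uniformly_small D C" and D: "D \<in> entourages" "sym D" "D O D O D \<subseteq> E"
  shows "uniformly_small E (closure C)"
  unfolding uniformly_small_def
proof (intro ballI allI)
  fix p q x assume "p \<in> closure C" "q \<in> closure C"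
  then obtain p' q' where "p' \<in> C" "(p x, p' x) \<in> D" "q' \<in> C" "(q x, q' x) \<in> D"
    using closure_eventually_ex[OF _ eventually_nhds_apply[OF D(1)]] by metis
  moreover from this have "(p' x, q' x) \<in> D" using C unfolding uniformly_small_def by blast
  ultimately have "(p x, q x) \<in> D O D O D" using D(2) by (meson relcompI symD)
  then show "(p x, q x) \<in> E" using D(3) by blast
qed

lemma small_cover_subset: "small_cover E F \<Longrightarrow> S \<subseteq> F \<Longrightarrow> small_cover E S"
  unfolding small_cover_def by (meson order_trans)

text \<open>If \<open>F\<close> had no finite cover at scale \<open>E\<close>, greedy choice would
  give a \<open>D\<close>-separated sequence in \<open>F\<close>; its range is countable, and the
  pigeonhole principle denies it a finite \<open>D\<close>-small cover.\<close>

lemma small_cover_if_countable: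
  fixes F :: "('b \<Rightarrow> 'a) set"
  assumes D: "sym D" "D O D \<subseteq> E"
    and S: "\<And>S. countable S \<Longrightarrow> S \<subseteq> F \<Longrightarrow> small_cover D S"
  shows "small_cover E F"
proof (rule ccontr)
  assume not: "\<not> small_cover E F"
  have "\<exists>f. \<forall>n::nat. f n \<in> F \<and> (\<forall>m<n. \<not> (\<forall>x. (f m x, f n x) \<in> D))"
  proof (rule dependent_wellorder_choice)
    fix n :: nat and f :: "nat \<Rightarrow> 'b \<Rightarrow> 'a"
    \<comment> \<open>The \<open>D\<close>-neighbourhoods of the earlier terms are
      \<open>E\<close>-small, so finitely many of them cannot exhaust \<open>F\<close>.\<close>
    define C where "C m = {p. \<forall>x. (f m x, p x) \<in> D}" for m
    have "uniformly_small E (C m)" for m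
      unfolding uniformly_small_def
    proof (intro ballI allI)
      fix p q x assume "p \<in> C m" "q \<in> C m"
      then have "(p x, q x) \<in> D O D" using D(1) unfolding C_def by (blast dest: symD)
      then show "(p x, q x) \<in> E" using D(2) by blast
    qed
    then have "\<not> F \<subseteq> \<Union>(C ` {..<n})"
      using not unfolding small_cover_def by (metis finite_imageI finite_lessThan imageE)
    then obtain r where r: "r \<in> F" "r \<notin> \<Union>(C ` {..<n})" by (meson subsetI)
    have "\<not> (\<forall>x. (f m x, r x) \<in> D)" if "m < n" for m
      using r(2) that unfolding C_def by simp
    then show "\<exists>r. r \<in> F \<and> (\<forall>m<n. \<not> (\<forall>x. (f m x, r x) \<in> D))" using r(1) by metis
  qed auto
  then obtain f where f: "\<And>n::nat. f n \<in> F" "\<And>m n. m < n \<Longrightarrow> \<not> (\<forall>x. (f m x, f n x) \<in> D)" by metis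
  have "small_cover D (range f)" using f(1) by (intro S) auto
  then obtain \<C> where \<C>: "finite \<C>" "range f \<subseteq> \<Union>\<C>" "\<And>C. C \<in> \<C> \<Longrightarrow> uniformly_small D C"
    unfolding small_cover_def by metis
  have "\<exists>C\<in>\<C>. f n \<in> C" for n using \<C>(2) by auto
  then obtain c where c: "\<And>n. c n \<in> \<C>" "\<And>n. f n \<in> c n" by metis
  have "\<not> inj c"
    using c(1) \<C>(1) by (metis finite_subset image_subsetI infinite_UNIV_nat finite_imageD)
  then obtain m n where mn: "m < n" "c m = c n"
    unfolding inj_def by (metis linorder_neqE_nat)
  then have "\<forall>x. (f m x, f n x) \<in> D"
    using c \<C>(3) unfolding uniformly_small_def by metis
  then show False using f(2) mn(1) by blast
qed

text \<open>Pairs \<open>(x, y)\<close> with \<open>p x\<close> and \<open>p y\<close> close are handled by the continuity of \<open>p\<close>, all others are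
  separated by some map in \<open>S\<close>; compactness of the square leaves finitely many maps.\<close>

lemma finite_modulus:
  fixes S :: "('a::uniform_space \<Rightarrow> 'a) set"
  assumes comp: "compact (UNIV :: 'a set)"
    and S: "\<And>s. s \<in> S \<Longrightarrow> continuous_on UNIV s"
    and p: "p \<in> closure S" "continuous_on UNIV p"
    and D: "D \<in> entourages" "sym D" "D O D O D O D \<subseteq> E"
    and V: "V \<in> entourages" "sym V" "V O V O V O V \<subseteq> D" "V \<subseteq> D"
  shows "\<exists>F. finite F \<and> F \<subseteq> S \<and> (\<forall>x y. (\<forall>s\<in>F. (s x, s y) \<in> V) \<longrightarrow> (p x, p y) \<in> E)"
proof -
  have fst: "\<forall>\<^sub>F w in nhds (a, b). (f a, f (fst w)) \<in> W"
    and snd: "\<forall>\<^sub>F w in nhds (a, b). (f b, f (snd w)) \<in> W"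
    if f: "continuous_on UNIV f" and W: "W \<in> entourages" for f :: "'a \<Rightarrow> 'a" and W and a b :: 'a
  proof -
    have "continuous_on UNIV (\<lambda>w::'a \<times> 'a. f (fst w))" "continuous_on UNIV (\<lambda>w::'a \<times> 'a. f (snd w))"
      by (rule continuous_on_compose2[OF f] continuous_intros subset_UNIV)+
    from this[THEN continuous_entourage, OF W, of "(a, b)"]
    show "\<forall>\<^sub>F w in nhds (a, b). (f a, f (fst w)) \<in> W" "\<forall>\<^sub>F w in nhds (a, b). (f b, f (snd w)) \<in> W"
      by simp_all
  qed
  have "\<exists>F. finite F \<and> F \<subseteq> S \<and>
      (\<forall>\<^sub>F w in nhds z. (\<forall>s\<in>F. (s (fst w), s (snd w)) \<in> V) \<longrightarrow> (p (fst w), p (snd w)) \<in> E)" for z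
  proof -
    obtain a b where z: "z = (a, b)" by (cases z)
    show ?thesis
    proof (cases "(p a, p b) \<in> D O D")
      case True
      have "\<forall>\<^sub>F w in nhds z. (p a, p (fst w)) \<in> D \<and> (p b, p (snd w)) \<in> D"
        unfolding z by (intro eventually_conj fst snd p(2) D(1))
      then have "\<forall>\<^sub>F w in nhds z. (p (fst w), p (snd w)) \<in> E"
      proof (rule eventually_mono)
        fix w assume w: "(p a, p (fst w)) \<in> D \<and> (p b, p (snd w)) \<in> D"
        obtain u where "(p a, u) \<in> D" "(u, p b) \<in> D" using True by (rule relcompE) auto
        then have "(p (fst w), p (snd w)) \<in> D O D O D O D" using w D(2) by (meson relcompI symD)
        then show "(p (fst w), p (snd w)) \<in> E" using D(3) by blast
      qed
      then show ?thesis by (intro exI[of _ "{}"]) simp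
    next
      case False
      \<comment> \<open>A member of \<open>S\<close> approximating \<open>p\<close> at the two
        points \<open>a\<close> and \<open>b\<close> keeps their images apart.\<close>
      have "\<forall>\<^sub>F q in nhds p. (p a, q a) \<in> V \<and> (p b, q b) \<in> V"
        by (intro eventually_conj eventually_nhds_apply V(1))
      then obtain s where s: "s \<in> S" "(p a, s a) \<in> V" "(p b, s b) \<in> V"
        using closure_eventually_ex[OF p(1)] by blast
      have "\<forall>\<^sub>F w in nhds z. (s a, s (fst w)) \<in> V \<and> (s b, s (snd w)) \<in> V"
        unfolding z by (intro eventually_conj fst snd S[OF s(1)] V(1))
      then have "\<forall>\<^sub>F w in nhds z. (s (fst w), s (snd w)) \<notin> V"
      proof (rule eventually_mono, intro notI)
        fix w assume w: "(s a, s (fst w)) \<in> V \<and> (s b, s (snd w)) \<in> V" "(s (fst w), s (snd w)) \<in> V"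
        \<comment> \<open>The path runs through \<open>s a\<close>, \<open>s (fst w)\<close> and
          \<open>s (snd w)\<close>; one more step to \<open>p b\<close> would put
          \<open>(p a, p b)\<close> into \<open>D O D\<close>.\<close>
        have "(p a, s b) \<in> V O V O V O V" using w s(2) V(2) by (meson relcompI symD)
        then have "(p a, s b) \<in> D" using V(3) by blast
        moreover have "(s b, p b) \<in> D" using s(3) V(2,4) by (meson symD subsetD)
        ultimately show False using False by blast
      qed
      then have "\<forall>\<^sub>F w in nhds z. (\<forall>s\<in>{s}. (s (fst w), s (snd w)) \<in> V) \<longrightarrow> (p (fst w), p (snd w)) \<in> E"
        by (rule eventually_mono) simp
      then show ?thesis using s(1) by (intro exI[of _ "{s}"]) simp
    qed
  qed
  then have "\<exists>F. \<forall>z. finite (F z) \<and> F z \<subseteq> S \<and>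
      (\<forall>\<^sub>F w in nhds z. (\<forall>s\<in>F z. (s (fst w), s (snd w)) \<in> V) \<longrightarrow> (p (fst w), p (snd w)) \<in> E)"
    by (intro choice allI)
  then obtain F where F: "\<And>z. finite (F z)" "\<And>z. F z \<subseteq> S"
    "\<And>z. \<forall>\<^sub>F w in nhds z. (\<forall>s\<in>F z. (s (fst w), s (snd w)) \<in> V) \<longrightarrow> (p (fst w), p (snd w)) \<in> E"
    by blast
  have "compact (UNIV :: ('a \<times> 'a) set)"
    using compact_Times[OF comp comp] by simp
  from compact_UNIV_cover[OF this F(3)] obtain P where P: "finite P"
    "\<forall>w. \<exists>z\<in>P. (\<forall>s\<in>F z. (s (fst w), s (snd w)) \<in> V) \<longrightarrow> (p (fst w), p (snd w)) \<in> E"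
    by (elim exE conjE)
  have "(p x, p y) \<in> E" if xy: "\<forall>s\<in>\<Union>(F ` P). (s x, s y) \<in> V" for x y
  proof -
    obtain z where "z \<in> P" "(\<forall>s\<in>F z. (s x, s y) \<in> V) \<longrightarrow> (p x, p y) \<in> E"
      using P(2)[THEN spec, of "(x, y)"] by auto
    then show ?thesis using xy by blast
  qed
  moreover have "finite (\<Union>(F ` P))" using P(1) F(1) by simp
  moreover have "\<Union>(F ` P) \<subseteq> S" by (rule UN_least) (rule F(2))
  ultimately show ?thesis by (intro exI[of _ "\<Union>(F ` P)"]) simp
qed

text \<open>Since \<open>F\<close> is a finite set of continuous maps, the condition through
  \<open>F\<close> and \<open>V\<close> is a common modulus for all these \<open>p\<close>, so
  finitely many sample points determine them.\<close>

lemma finite_modulus_small_cover: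
  fixes F G :: "('a::uniform_space \<Rightarrow> 'a) set"
  assumes comp: "compact (UNIV :: 'a set)" and F: "finite F" "\<And>s. s \<in> F \<Longrightarrow> continuous_on UNIV s"
    and V: "V \<in> entourages" "sym V"
    and D: "D \<in> entourages" "sym D" "D O D O D O D \<subseteq> E"
  shows "small_cover E {p \<in> G. \<forall>x y. (\<forall>s\<in>F. (s x, s y) \<in> V) \<longrightarrow> (p x, p y) \<in> D}"
proof -
  have "\<forall>\<^sub>F y in nhds x. \<forall>s\<in>F. (s x, s y) \<in> V" for x
    using F V(1) by (intro eventually_ball_finite ballI continuous_entourage) auto
  from compact_UNIV_cover[OF comp this] obtain P where
    P: "finite P" "\<forall>y. \<exists>x\<in>P. \<forall>s\<in>F. (s x, s y) \<in> V" by metis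
  have "\<exists>z\<in>P. \<forall>p\<in>{p \<in> G. \<forall>x y. (\<forall>s\<in>F. (s x, s y) \<in> V) \<longrightarrow> (p x, p y) \<in> D}. (p x, p z) \<in> D" for x
  proof -
    obtain z where z: "z \<in> P" "\<forall>s\<in>F. (s z, s x) \<in> V" using P(2) by metis
    then have "\<forall>s\<in>F. (s x, s z) \<in> V" using V(2) by (meson symD)
    then show ?thesis using z(1) by (intro bexI[of _ z]) auto
  qed
  then show ?thesis by (rule small_coverI[OF comp D P(1)])
qed

text \<open>The closures of countably many cells cover a nonempty compact Hausdorff space, so one
  has interior; passing to the closure loosens the scale from \<open>D\<close> to
  \<open>E\<close>.\<close>

lemma Baire_uniformly_small:
  fixes G :: "('b \<Rightarrow> 'a::{uniform_space, t2_space}) set"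
  assumes G: "compact G" "G \<noteq> {}" and \<C>: "countable \<C>" "G \<subseteq> \<Union>\<C>" "\<And>C. C \<in> \<C> \<Longrightarrow> uniformly_small D C"
    and D: "D \<in> entourages" "sym D" "D O D O D \<subseteq> E"
  shows "\<exists>U. open U \<and> U \<inter> G \<noteq> {} \<and> uniformly_small E (U \<inter> G)"
proof -
  define X where "X = top_of_set G"
  have cX: "compact_space X" unfolding X_def using G(1) by (simp add: compact_space_subtopology)
  have hX: "Hausdorff_space X" unfolding X_def by (rule Hausdorff_space_subtopology[OF Hausdorff_space_fun])
  have X: "locally_compact_space X" "regular_space X"
    using cX hX by (simp_all add: compact_imp_locally_compact_space compact_Hausdorff_imp_regular_space)
  define \<T> where "\<T> = (\<lambda>C. closure C \<inter> G) ` \<C>"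
  have top: "\<Union>\<T> = topspace X"
  proof
    show "topspace X \<subseteq> \<Union>\<T>"
    proof
      fix p assume "p \<in> topspace X"
      then have p: "p \<in> G" by (simp add: X_def)
      then obtain C where "C \<in> \<C>" "p \<in> C" using \<C>(2) by (meson UnionE subsetD)
      then show "p \<in> \<Union>\<T>" using p closure_subset[of C] unfolding \<T>_def by auto
    qed
  qed (auto simp: \<T>_def X_def)
  have "\<exists>T\<in>\<T>. X interior_of T \<noteq> {}"
  proof (rule ccontr)
    assume "\<not> (\<exists>T\<in>\<T>. X interior_of T \<noteq> {})"
    moreover have "closedin X T" if "T \<in> \<T>" for T
      using that unfolding \<T>_def X_def by (auto simp: closedin_subtopology)
    ultimately have "X interior_of \<Union>\<T> = {}"
      using X \<C>(1) unfolding \<T>_def by (intro Baire_category_alt) auto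
    then show False using G(2) unfolding top interior_of_topspace by (simp add: X_def)
  qed
  then obtain C where C: "C \<in> \<C>" "X interior_of (closure C \<inter> G) \<noteq> {}" unfolding \<T>_def by blast
  have "openin X (X interior_of (closure C \<inter> G))" by (rule openin_interior_of)
  then obtain U where U: "open U" "X interior_of (closure C \<inter> G) = U \<inter> G"
    unfolding X_def openin_subtopology by auto
  have "U \<inter> G \<subseteq> closure C" using interior_of_subset[of X "closure C \<inter> G"] U(2) by simp
  then have "uniformly_small E (U \<inter> G)"
    using uniformly_small_closure[OF \<C>(3)[OF C(1)] D] unfolding uniformly_small_def by (meson subsetD)
  then show ?thesis using U C(2) by metis
qed

text \<open>Right translation is continuous and only changes the points at which maps are compared,
  so it preserves uniform smallness; finitely many right translates of \<open>U\<close> cover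
  \<open>G\<close>.\<close>

lemma group_small_cover:
  fixes G :: "('a::topological_space \<Rightarrow> 'a) set"
  assumes G: "compact G" "\<And>p q. p \<in> G \<Longrightarrow> q \<in> G \<Longrightarrow> p \<circ> q \<in> G" "\<And>p. p \<in> G \<Longrightarrow> bij p \<and> inv p \<in> G"
    and U: "open U" "u \<in> U" "u \<in> G" "uniformly_small E (U \<inter> G)"
  shows "small_cover E G"
proof -
  \<comment> \<open>Right multiplication by \<open>inv g \<circ> u\<close> carries \<open>g\<close>
    to \<open>u\<close>, so \<open>C g\<close> is a translate of \<open>U\<close> that contains
    \<open>g\<close>.\<close>
  define C where "C g = {p. p \<circ> (inv g \<circ> u) \<in> U}" for g :: "'a \<Rightarrow> 'a"
  have C: "open (C g)" for g
    using open_vimage[OF U(1) continuous_precompose] unfolding C_def vimage_def .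
  have gC: "g \<in> C g" if "g \<in> G" for g
  proof -
    have "g \<circ> (inv g \<circ> u) = u"
      using G(3)[OF that] by (simp add: fun_eq_iff bij_is_surj surj_f_inv_f)
    then show ?thesis using U(2) unfolding C_def by simp
  qed
  obtain P where P: "P \<subseteq> G" "finite P" "G \<subseteq> (\<Union>g\<in>P. C g)"
    by (rule compactE_image[OF G(1), of G C]) (use C gC in auto)
  have "uniformly_small E (C g \<inter> G)" if g: "g \<in> P" for g
    unfolding uniformly_small_def
  proof (intro ballI allI)
    fix p q x assume pq: "p \<in> C g \<inter> G" "q \<in> C g \<inter> G"
    define r where "r = inv g \<circ> u"
    have r: "r \<in> G" using G(2,3) U(3) g P(1) unfolding r_def by blast
    then have "p \<circ> r \<in> U \<inter> G" "q \<circ> r \<in> U \<inter> G" using pq G(2) unfolding C_def r_def by blast+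
    then have "(p (r y), q (r y)) \<in> E" for y using U(4) unfolding uniformly_small_def by (metis comp_apply)
    moreover have "r (inv r x) = x" using G(3)[OF r] by (simp add: bij_is_surj surj_f_inv_f)
    ultimately show "(p x, q x) \<in> E" by metis
  qed
  moreover have "G \<subseteq> \<Union>((\<lambda>g. C g \<inter> G) ` P)" using P(3) by auto
  ultimately show ?thesis
    unfolding small_cover_def using P(2) by (intro exI[of _ "(\<lambda>g. C g \<inter> G) ` P"]) auto
qed

text \<open>Countability enters through the finite subsets of \<open>S\<close>: each
  \<open>p\<close> in \<open>G\<close> has a modulus given by one of them, so countably many small
  sets suffice to cover \<open>G\<close>, as Baire category demands.\<close>

lemma aa_small_cover_countable:
  fixes \<pi> :: "'t::topological_monoid_mult \<Rightarrow> 'x::{uniform_space, t2_space} \<Rightarrow> 'x"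
  assumes comp: "compact (UNIV :: 'x set)" and flow: "semiflow \<pi>"
    and bij: "\<And>t. bij (\<pi> t)" and aa: "P_aa \<pi> = UNIV" and minimal: "minimal_semiflow \<pi>"
    and E: "E \<in> entourages" and T: "countable T"
  shows "small_cover E (\<pi> ` T)"
proof -
  \<comment> \<open>Products of lists over \<open>T\<close> form the submonoid generated by
    \<open>T\<close>; the empty list contributes \<open>\<pi> 1\<close>.\<close>
  define S where "S = \<pi> ` prod_list ` lists T"
  have TS: "\<pi> ` T \<subseteq> S"
  proof -
    have "t \<in> prod_list ` lists T" if "t \<in> T" for t
      using that by (intro image_eqI[of _ _ "[t]"]) auto
    then show ?thesis unfolding S_def by blast
  qed
  have mult: "s \<circ> t \<in> S" if st: "s \<in> S" "t \<in> S" for s t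
  proof -
    obtain k l where "k \<in> lists T" "l \<in> lists T" "s = \<pi> (prod_list k)" "t = \<pi> (prod_list l)"
      using st unfolding S_def by blast
    then have "s \<circ> t = \<pi> (prod_list (k @ l))" "k @ l \<in> lists T"
      by (simp_all add: semiflow_comp[OF flow])
    then show ?thesis unfolding S_def by blast
  qed
  have S: "S \<subseteq> range \<pi>" "countable S" "S \<noteq> {}"
    using T unfolding S_def by auto
  have cont: "continuous_on UNIV s" if "s \<in> S" for s
    using that semiflow_continuous[OF flow] S(1) by blast
  define G where "G = closure S"
  have GE: "G \<subseteq> closure (range \<pi>)" unfolding G_def using S(1) by (rule closure_mono)
  have compG: "compact G"
    using compact_Int_closed[OF compact_UNIV_fun[OF comp], of G] unfolding G_def by simp
  have SG: "S \<subseteq> G" unfolding G_def by (rule closure_subset)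
  then have neG: "G \<noteq> {}" using S(3) by auto
  have multG: "p \<circ> q \<in> G" if "p \<in> G" "q \<in> G" for p q
    unfolding G_def by (rule closure_closed_under_comp[OF cont mult]) (use that G_def in auto)
  have groupG: "bij p \<and> inv p \<in> G" if "p \<in> G" for p
  proof (rule injective_compact_semigroup_is_group[OF compG neG multG _ that])
    fix q assume "q \<in> G"
    then show "inj q" using GE enveloping_inj[OF comp flow bij aa] by blast
  qed
  \<comment> \<open>Read backwards: \<open>V\<close> tests members of \<open>S\<close>,
    \<open>D\<close> separates pairs in \<open>finite_modulus\<close>, \<open>E2\<close> bounds the
    resulting modulus, \<open>E1\<close> the covering sets, and \<open>E\<close> absorbs their
    closures.\<close>
  obtain E1 where E1: "E1 \<in> entourages" "sym E1" "E1 O E1 O E1 \<subseteq> E" by (rule entourage_quarter[OF E])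
  obtain E2 where E2: "E2 \<in> entourages" "sym E2" "E2 O E2 O E2 O E2 \<subseteq> E1" by (rule entourage_quarter[OF E1(1)])
  obtain D where D: "D \<in> entourages" "sym D" "D O D O D O D \<subseteq> E2" by (rule entourage_quarter[OF E2(1)])
  obtain V where V: "V \<in> entourages" "sym V" "V O V O V O V \<subseteq> D" "V \<subseteq> D" by (rule entourage_quarter[OF D(1)])
  define H where "H F = {p \<in> G. \<forall>x y. (\<forall>s\<in>F. (s x, s y) \<in> V) \<longrightarrow> (p x, p y) \<in> E2}" for F
  define \<F> where "\<F> = {F. finite F \<and> F \<subseteq> S}"
  have "small_cover E1 (H F)" if "F \<in> \<F>" for F
    unfolding H_def using that cont unfolding \<F>_def
    by (intro finite_modulus_small_cover[OF comp _ _ V(1,2) E2]) auto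
  then obtain \<C> where \<C>: "\<And>F. F \<in> \<F> \<Longrightarrow> finite (\<C> F)" "\<And>F. F \<in> \<F> \<Longrightarrow> H F \<subseteq> \<Union>(\<C> F)"
    "\<And>F C. F \<in> \<F> \<Longrightarrow> C \<in> \<C> F \<Longrightarrow> uniformly_small E1 C"
    unfolding small_cover_def by metis
  have "countable \<F>" unfolding \<F>_def using S(2) by (rule countable_Collect_finite_subset)
  then have "countable (\<Union>(\<C> ` \<F>))" using \<C>(1) by (simp add: countable_finite)
  moreover have "G \<subseteq> \<Union>(\<Union>(\<C> ` \<F>))"
  proof
    fix p assume p: "p \<in> G"
    have "continuous_on UNIV p"
      using enveloping_continuous[OF comp flow bij aa minimal] GE p by blast
    with finite_modulus[OF comp cont p[unfolded G_def] _ D V]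
    obtain F where F: "F \<in> \<F>" "\<forall>x y. (\<forall>s\<in>F. (s x, s y) \<in> V) \<longrightarrow> (p x, p y) \<in> E2"
      unfolding \<F>_def by auto
    then have "p \<in> H F" using p unfolding H_def by simp
    then show "p \<in> \<Union>(\<Union>(\<C> ` \<F>))" using \<C>(2)[OF F(1)] F(1) by blast
  qed
  moreover have "uniformly_small E1 C" if "C \<in> \<Union>(\<C> ` \<F>)" for C using that \<C>(3) by blast
  ultimately obtain U where U: "open U" "U \<inter> G \<noteq> {}" "uniformly_small E (U \<inter> G)"
    using Baire_uniformly_small[OF compG neG _ _ _ E1, of "\<Union>(\<C> ` \<F>)"] by metis
  then obtain u where u: "u \<in> U" "u \<in> G" by blast
  have "small_cover E G" by (rule group_small_cover[OF compG multG groupG U(1) u U(3)])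
  then show ?thesis using TS SG by (blast intro: small_cover_subset)
qed

text \<open>Total boundedness can be tested on countable families, and a countable family of
  transitions comes from a countable set of times.\<close>

lemma aa_imp_uniformly_equicontinuous:
  fixes \<pi> :: "'t::topological_monoid_mult \<Rightarrow> 'x::{uniform_space, t2_space} \<Rightarrow> 'x"
  assumes comp: "compact (UNIV :: 'x set)" and flow: "semiflow \<pi>"
    and bij: "\<And>t. bij (\<pi> t)" and aa: "P_aa \<pi> = UNIV" and minimal: "minimal_semiflow \<pi>"
  shows "uniformly_equicontinuous (range \<pi>)"
proof (rule small_cover_imp_uniformly_equicontinuous[OF comp])
  fix E :: "('x \<times> 'x) set"
  assume "E \<in> entourages"
  then obtain D where D: "D \<in> entourages" "sym D" "D O D \<subseteq> E" by (rule entourage_half)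
  show "small_cover E (range \<pi>)"
  proof (rule small_cover_if_countable[OF D(2,3)])
    fix S assume "countable S" "S \<subseteq> range \<pi>"
    then obtain T where "countable T" "S = \<pi> ` T" by (metis countable_subset_image)
    then show "small_cover D S" using aa_small_cover_countable[OF comp flow bij aa minimal D(1)] by simp
  qed
qed (auto simp: semiflow_continuous[OF flow])

section \<open>Injectivity from almost automorphy, and the equivalences\<close>

lemma aa_imp_injective:
  assumes "P_aa \<pi> = UNIV"
  shows "inj (\<pi> t)"
proof (rule injI)
  fix x x' assume eq: "\<pi> t x = \<pi> t x'"
  \<comment> \<open>Almost automorphy is tested on a one-point net with time \<open>t\<close> and
    preimage \<open>x'\<close>.\<close>
  have "aa_point_wrt TYPE(unit) \<pi> x" using assms by (intro P_aa_all_nets) simp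
  moreover have "directed_preorder_on {()} (\<lambda>_ _. True)"
    by (auto simp: directed_preorder_on_def reflp_on_def transp_on_def)
  ultimately show "x = x'"
    unfolding aa_point_wrt_def
    by (elim allE[of _ "{()}"] allE[of _ "\<lambda>_ _. True"] allE[of _ "\<lambda>_. t"] allE[of _ "\<lambda>_. x'"]
        allE[of _ "\<pi> t x"] allE[of _ x']) (simp add: eq)
qed

theorem theorem4p5:
  fixes \<pi> :: "'t::topological_monoid_mult \<Rightarrow> 'x::{uniform_space, t2_space} \<Rightarrow> 'x"
  assumes "compact (UNIV :: 'x set)"
    and "semiflow \<pi>"
    and "minimal_semiflow \<pi>"
    and "surjective_semiflow \<pi>"
  shows "(P_aa \<pi> = UNIV \<longleftrightarrow> equicontinuous_semiflow \<pi> \<and> invertible_semiflow \<pi>) \<and>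
         (equicontinuous_semiflow \<pi> \<and> invertible_semiflow \<pi> \<longleftrightarrow> ap_semiflow \<pi>)"
proof -
  note eq_iff = equicontinuous_semiflow_iff[OF assms(1), of \<pi>]
  have surj: "surj (\<pi> t)" for t using assms(4) unfolding surjective_semiflow_def by blast
  have "equicontinuous_semiflow \<pi> \<and> invertible_semiflow \<pi>" if aa: "P_aa \<pi> = UNIV"
  proof -
    have "bij (\<pi> t)" for t using aa_imp_injective[OF aa] surj by (intro bijI)
    then show ?thesis
      using aa_imp_uniformly_equicontinuous[OF assms(1,2) _ aa assms(3)]
      unfolding eq_iff invertible_semiflow_def by simp
  qed
  moreover have "P_aa \<pi> = UNIV" "ap_semiflow \<pi>" if "equicontinuous_semiflow \<pi>"
    using equicontinuous_imp_aa[OF assms(1,2,4)] equicontinuous_imp_ap[OF assms(1,2,4)] that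
    unfolding eq_iff P_aa_def by auto
  moreover have "equicontinuous_semiflow \<pi> \<and> invertible_semiflow \<pi>" if ap: "ap_semiflow \<pi>"
  proof -
    have "bij (\<pi> t)" for t using ap_imp_injective[OF assms(2) ap] surj by (intro bijI)
    then show ?thesis
      using ap_imp_uniformly_equicontinuous[OF assms(1,2) ap]
      unfolding eq_iff invertible_semiflow_def by simp
  qed
  ultimately show ?thesis by blast
qed

end
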